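(* Let $N\ge1$, $M\ge2$, let $\Omega\subset\mathbb{R}^N$ be open with smooth boundary, $1\le p<2/(N-2)^+$ and $\omega_1,\dots,\omega_M>0$. Consider the system $$\Delta u_i-\omega_iu_i+\mu|u_i|^{2p}u_i+\beta\sum_{j\ne i}|u_j|^{p+1}|u_i|^{p-1}u_i=0\ \text{ on }\Omega,\qquad i=1,\dots,M,$$ with $\mu>0$ and $\beta>0$ (that is, $k_{ii}=\mu$ for all $i$ and $k_{ij}=\beta$ for all $i\neq j$). Then there exists $\delta>0$ (depending on $\Omega,N,M,p,\omega_1,\dots,\omega_M$ only) such that, if $0<\beta<\delta\mu$, every ground-state of the system has exactly one nonzero component.
   Context: Convention: $2/(N-2)^+=+\infty$ if $N=1,2$ and $2/(N-2)^+=2/(N-2)$ if $N\ge3$. Functions in $H^1_0(\Omega)$ are complex-valued. A bound-state is an element $U=(u_1,\dots,u_M)\in (H^1_0(\Omega))^M\setminus\{0\}$ solving the system. Put $$I(U)=\sum_{i=1}^M\int_\Omega\left(|\nabla u_i|^2+\omega_i|u_i|^2\right),\quad J(U)=\sum_{i,j=1}^M k_{ij}\int_\Omega|u_i|^{p+1}|u_j|^{p+1},\quad S(U)=\tfrac12I(U)-\tfrac1{2p+2}J(U).$$ A ground-state is a bound-state $U$ with $S(U)\le S(W)$ for every bound-state $W$; $G$ denotes the set of ground-states. Standing assumption (Exist): the set of ground-states is nonempty for the systems considered (including the subsystems obtained by keeping only some of the components). Standing fact recalled by the paper from earlier work: under this assumption (and since $J(U)>0$ for some $U$), $G$ is exactly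 the set of solutions of $I(U)=\min_{J(W)=\lambda_G}I(W)$, $J(U)=\lambda_G$, where $\lambda_G=\left(\inf_{J(W)=1}I(W)\right)^{(p+1)/p}$. *)

theory Defs
  imports "HOL-Analysis.Analysis"
begin

text \<open>
  Functions on \<open>\<Omega>\<close> are total functions, of which only the values on \<open>\<Omega>\<close> up to null sets matter;
  \<open>\<Omega>\<close> carries Lebesgue measure and \<open>N\<close> is the dimension of the ambient Euclidean space.
\<close>

text \<open>The exponent \<open>2 / (N - 2)\<^sup>+\<close>.\<close>

definition critical_exponent :: "nat \<Rightarrow> ereal" where
  "critical_exponent N = (if N \<le> 2 then \<infinity> else ereal (2 / (real N - 2)))"

primrec C_k :: "nat \<Rightarrow> ('a::euclidean_space \<Rightarrow> 'b::real_normed_vector) \<Rightarrow> bool" where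
  "C_k 0 f \<longleftrightarrow> continuous_on UNIV f"
| "C_k (Suc k) f \<longleftrightarrow>
     f differentiable_on UNIV \<and> (\<forall>v. C_k k (\<lambda>x. frechet_derivative f (at x) v))"

definition smooth :: "('a::euclidean_space \<Rightarrow> 'b::real_normed_vector) \<Rightarrow> bool" where
  "smooth f \<longleftrightarrow> (\<forall>k. C_k k f)"

text \<open>
  Near each boundary point, after a rotation taking \<open>e\<close> to the last coordinate direction,
  \<open>\<Omega>\<close> is the region above the graph of a smooth function \<open>\<gamma>\<close> of the remaining coordinates,
  i.e. of the projection onto the hyperplane orthogonal to \<open>e\<close>.
\<close>

definition smooth_boundary :: "'a::euclidean_space set \<Rightarrow> bool" where
  "smooth_boundary \<Omega> \<longleftrightarrow>
     (\<forall>x\<^sub>0 \<in> frontier \<Omega>. \<exists>r>0. \<exists>e. \<exists>\<gamma>::'a \<Rightarrow> real. norm e = 1 \<and> smooth \<gamma> \<and>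
        \<Omega> \<inter> ball x\<^sub>0 r = {x \<in> ball x\<^sub>0 r. x \<bullet> e > \<gamma> (x - (x \<bullet> e) *\<^sub>R e)})"

definition test_fun :: "'a::euclidean_space set \<Rightarrow> ('a \<Rightarrow> complex) set" where
  "test_fun \<Omega> = {\<phi>. smooth \<phi> \<and> (\<exists>C. compact C \<and> C \<subseteq> \<Omega> \<and> (\<forall>x. x \<notin> C \<longrightarrow> \<phi> x = 0))}"

definition L2 :: "'a::euclidean_space set \<Rightarrow> ('a \<Rightarrow> complex) set" where
  "L2 \<Omega> = {f \<in> borel_measurable (lebesgue_on \<Omega>). integrable (lebesgue_on \<Omega>) (\<lambda>x. (cmod (f x))\<^sup>2)}"

definition has_weak_pderiv ::
  "'a::euclidean_space set \<Rightarrow> 'a \<Rightarrow> ('a \<Rightarrow> complex) \<Rightarrow> ('a \<Rightarrow> complex) \<Rightarrow> bool" where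
  "has_weak_pderiv \<Omega> b u w \<longleftrightarrow> w \<in> L2 \<Omega> \<and>
     (\<forall>\<phi>\<in>test_fun \<Omega>. (\<integral>x. u x * frechet_derivative \<phi> (at x) b \<partial>lebesgue_on \<Omega>)
        = - (\<integral>x. w x * \<phi> x \<partial>lebesgue_on \<Omega>))"

text \<open>The weak partial derivative is determined up to null sets, whence the choice of a representative.\<close>

definition weak_pderiv ::
  "'a::euclidean_space set \<Rightarrow> 'a \<Rightarrow> ('a \<Rightarrow> complex) \<Rightarrow> 'a \<Rightarrow> complex" where
  "weak_pderiv \<Omega> b u = (SOME w. has_weak_pderiv \<Omega> b u w)"

definition H1 :: "'a::euclidean_space set \<Rightarrow> ('a \<Rightarrow> complex) set" where
  "H1 \<Omega> = {u \<in> L2 \<Omega>. \<forall>b\<in>Basis. \<exists>w. has_weak_pderiv \<Omega> b u w}"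

definition grad_sq :: "'a::euclidean_space set \<Rightarrow> ('a \<Rightarrow> complex) \<Rightarrow> 'a \<Rightarrow> real" where
  "grad_sq \<Omega> u x = (\<Sum>b\<in>Basis. (cmod (weak_pderiv \<Omega> b u x))\<^sup>2)"

definition H1_norm :: "'a::euclidean_space set \<Rightarrow> ('a \<Rightarrow> complex) \<Rightarrow> real" where
  "H1_norm \<Omega> u = sqrt (\<integral>x. grad_sq \<Omega> u x + (cmod (u x))\<^sup>2 \<partial>lebesgue_on \<Omega>)"

definition H10 :: "'a::euclidean_space set \<Rightarrow> ('a \<Rightarrow> complex) set" where
  "H10 \<Omega> = {u \<in> H1 \<Omega>. \<exists>\<phi>::nat \<Rightarrow> 'a \<Rightarrow> complex. (\<forall>n. \<phi> n \<in> test_fun \<Omega>) \<and>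
      (\<lambda>n. H1_norm \<Omega> (\<lambda>x. \<phi> n x - u x)) \<longlonglongrightarrow> 0}"

definition zero_on :: "'a::euclidean_space set \<Rightarrow> ('a \<Rightarrow> complex) \<Rightarrow> bool" where
  "zero_on \<Omega> u \<longleftrightarrow> (AE x in lebesgue_on \<Omega>. u x = 0)"

text \<open>
  \<open>K\<close> is the set of indices of the components that are kept; the values of \<open>U\<close> outside \<open>K\<close> are
  irrelevant. The full system of \<open>M\<close> equations is \<open>K = {1..M}\<close>.
\<close>

definition H10_vec :: "'a::euclidean_space set \<Rightarrow> nat set \<Rightarrow> (nat \<Rightarrow> 'a \<Rightarrow> complex) set" where
  "H10_vec \<Omega> K = {U. \<forall>i\<in>K. U i \<in> H10 \<Omega>}"

definition I_fun ::
  "'a::euclidean_space set \<Rightarrow> (nat \<Rightarrow> real) \<Rightarrow> nat set \<Rightarrow> (nat \<Rightarrow> 'a \<Rightarrow> complex) \<Rightarrow> real" where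
  "I_fun \<Omega> \<omega> K U =
     (\<Sum>i\<in>K. \<integral>x. grad_sq \<Omega> (U i) x + \<omega> i * (cmod (U i x))\<^sup>2 \<partial>lebesgue_on \<Omega>)"

text \<open>
  The integrands of \<open>J\<close> are nonnegative, so they are integrated in the extended sense; a divergent
  integral counts as \<open>\<infinity>\<close> rather than as the default value \<open>0\<close> of the Bochner integral. For
  subcritical \<open>p\<close> the integrals are finite on \<open>H10\<close> by the Sobolev embedding.
\<close>

definition J_fun ::
  "'a::euclidean_space set \<Rightarrow> real \<Rightarrow> (nat \<Rightarrow> nat \<Rightarrow> real) \<Rightarrow> nat set
     \<Rightarrow> (nat \<Rightarrow> 'a \<Rightarrow> complex) \<Rightarrow> ereal" where
  "J_fun \<Omega> p k K U = (\<Sum>i\<in>K. \<Sum>j\<in>K. ereal (k i j) *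
     enn2ereal (\<integral>\<^sup>+x. ennreal (cmod (U i x) powr (p + 1) * cmod (U j x) powr (p + 1)) \<partial>lebesgue_on \<Omega>))"

definition action ::
  "'a::euclidean_space set \<Rightarrow> real \<Rightarrow> (nat \<Rightarrow> real) \<Rightarrow> (nat \<Rightarrow> nat \<Rightarrow> real) \<Rightarrow> nat set
     \<Rightarrow> (nat \<Rightarrow> 'a \<Rightarrow> complex) \<Rightarrow> ereal" where
  "action \<Omega> p \<omega> k K U = ereal (I_fun \<Omega> \<omega> K U / 2) - J_fun \<Omega> p k K U / ereal (2 * p + 2)"

text \<open>
  The weak form of \<open>\<Delta>u\<^sub>i - \<omega>\<^sub>i u\<^sub>i + (\<Sum>j\<in>K. k\<^sub>i\<^sub>j |u\<^sub>j|\<^bsup>p+1\<^esup> |u\<^sub>i|\<^bsup>p-1\<^esup> u\<^sub>i) = 0\<close> for \<open>i \<in> K\<close>;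
  the term \<open>j = i\<close> is \<open>k\<^sub>i\<^sub>i |u\<^sub>i|\<^bsup>2p\<^esup> u\<^sub>i\<close>.
\<close>

definition solves_system ::
  "'a::euclidean_space set \<Rightarrow> real \<Rightarrow> (nat \<Rightarrow> real) \<Rightarrow> (nat \<Rightarrow> nat \<Rightarrow> real) \<Rightarrow> nat set
     \<Rightarrow> (nat \<Rightarrow> 'a \<Rightarrow> complex) \<Rightarrow> bool" where
  "solves_system \<Omega> p \<omega> k K U \<longleftrightarrow> (\<forall>i\<in>K. \<forall>\<phi>\<in>test_fun \<Omega>.
     - (\<integral>x. (\<Sum>b\<in>Basis. weak_pderiv \<Omega> b (U i) x * frechet_derivative \<phi> (at x) b) \<partial>lebesgue_on \<Omega>)
     - complex_of_real (\<omega> i) * (\<integral>x. U i x * \<phi> x \<partial>lebesgue_on \<Omega>)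
     + (\<integral>x. (\<Sum>j\<in>K. complex_of_real
                  (k i j * cmod (U j x) powr (p + 1) * cmod (U i x) powr (p - 1)) * U i x) * \<phi> x
          \<partial>lebesgue_on \<Omega>) = 0)"

definition bound_states ::
  "'a::euclidean_space set \<Rightarrow> real \<Rightarrow> (nat \<Rightarrow> real) \<Rightarrow> (nat \<Rightarrow> nat \<Rightarrow> real) \<Rightarrow> nat set
     \<Rightarrow> (nat \<Rightarrow> 'a \<Rightarrow> complex) set" where
  "bound_states \<Omega> p \<omega> k K =
     {U \<in> H10_vec \<Omega> K. (\<exists>i\<in>K. \<not> zero_on \<Omega> (U i)) \<and> solves_system \<Omega> p \<omega> k K U}"

definition ground_states ::
  "'a::euclidean_space set \<Rightarrow> real \<Rightarrow> (nat \<Rightarrow> real) \<Rightarrow> (nat \<Rightarrow> nat \<Rightarrow> real) \<Rightarrow> nat set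
     \<Rightarrow> (nat \<Rightarrow> 'a \<Rightarrow> complex) set" where
  "ground_states \<Omega> p \<omega> k K =
     {U \<in> bound_states \<Omega> p \<omega> k K.
        \<forall>W\<in>bound_states \<Omega> p \<omega> k K. action \<Omega> p \<omega> k K U \<le> action \<Omega> p \<omega> k K W}"

definition lambda_G ::
  "'a::euclidean_space set \<Rightarrow> real \<Rightarrow> (nat \<Rightarrow> real) \<Rightarrow> (nat \<Rightarrow> nat \<Rightarrow> real) \<Rightarrow> nat set \<Rightarrow> real" where
  "lambda_G \<Omega> p \<omega> k K =
     (INF W\<in>{W \<in> H10_vec \<Omega> K. J_fun \<Omega> p k K W = 1}. I_fun \<Omega> \<omega> K W) powr ((p + 1) / p)"

definition minimizers ::
  "'a::euclidean_space set \<Rightarrow> real \<Rightarrow> (nat \<Rightarrow> real) \<Rightarrow> (nat \<Rightarrow> nat \<Rightarrow> real) \<Rightarrow> nat set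
     \<Rightarrow> (nat \<Rightarrow> 'a \<Rightarrow> complex) set" where
  "minimizers \<Omega> p \<omega> k K =
     {U \<in> H10_vec \<Omega> K. J_fun \<Omega> p k K U = ereal (lambda_G \<Omega> p \<omega> k K) \<and>
        (\<forall>W\<in>H10_vec \<Omega> K. J_fun \<Omega> p k K W = ereal (lambda_G \<Omega> p \<omega> k K)
            \<longrightarrow> I_fun \<Omega> \<omega> K U \<le> I_fun \<Omega> \<omega> K W)}"

definition coupling :: "real \<Rightarrow> real \<Rightarrow> nat \<Rightarrow> nat \<Rightarrow> real" where
  "coupling \<mu> \<beta> i j = (if i = j then \<mu> else \<beta>)"

end

theory Submission
  imports Defs
begin

text \<open>
  A ground-state minimises \<open>I\<close> on a level set of \<open>J\<close>, and the claim is that on such a set it is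
  cheaper to put everything into one component; the constant \<open>\<delta> = 1\<close> works.

  Put \<open>x\<^sub>i = \<parallel>u\<^sub>i\<parallel>\<^sup>2\<close>, the norm being that of \<open>L\<^bsup>2p+2\<^esup>\<close>, so that \<open>\<integral> |u\<^sub>i|\<^bsup>2p+2\<^esup> = x\<^sub>i\<^bsup>p+1\<^esup>\<close>. By the
  Cauchy-Schwarz inequality, a minimiser \<open>U\<close> at the level \<open>l\<close> satisfies
  \<open>l / \<mu> \<le> \<Sum> x\<^sub>i\<^bsup>p+1\<^esup> + (\<beta> / \<mu>) \<Sum> (x\<^sub>i x\<^sub>j)\<^bsup>(p+1)/2\<^esup>\<close>, the second sum being over \<open>i \<noteq> j\<close>. If \<open>\<beta> < \<mu>\<close>
  and two of the \<open>x\<^sub>i\<close> are positive, superadditivity of \<open>t \<mapsto> t\<^sup>p\<close> and the arithmetic-geometric mean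
  inequality show that the right-hand side is strictly less than \<open>(\<Sum> x\<^sub>i)\<^bsup>p+1\<^esup>\<close>
  (\<open>coupled_sum_less_powr_sum\<close>). If \<open>m\<close> is the nonzero component with the smallest quotient \<open>r\<close> of its
  energy by \<open>x\<^sub>m\<close>, then \<open>I U\<close> is at least \<open>r \<Sum> x\<^sub>i\<close>, hence greater than \<open>r (l / \<mu>)\<^bsup>1/(p+1)\<^esup>\<close>, which is
  the value of \<open>I\<close> at the multiple of \<open>u\<^sub>m\<close>, with all other components zero, that has the level \<open>l\<close>.
  So \<open>U\<close> is not a minimiser (\<open>minimizer_at_most_one_component\<close>).

  The competitor has to be admissible and its energy has to be known: the set \<open>H10\<close> must be closed
  under scalar multiplication and the energy must be homogeneous (\<open>H10_cmult\<close>, \<open>energy_cmult\<close>). Since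
  the weak gradient is an arbitrary choice of representatives, this requires weak derivatives to be
  unique up to null sets, which is the fundamental lemma of the calculus of variations
  (\<open>fundamental_lemma_L2\<close>). That lemma needs a supply of smooth functions with compact support, here
  products of \<open>exp (- 1 / t)\<close> approximating the indicator functions of boxes. Moreover the
  approximations by test functions in the definition of \<open>H10\<close> have to be scaled, and for this test
  functions must have weak derivatives, which is integration by parts (\<open>has_weak_pderiv_test_fun\<close>).
\<close>

section \<open>Smooth bump functions on boxes\<close>

text \<open>
The building block of the test functions, with its derivatives: the derivative of
\<open>(1 / t)\<^sup>m exp (- 1 / t)\<close> on \<open>t > 0\<close> is again a combination of functions of this form,
so that the whole family is handled at once.
\<close>

definition flat :: "nat \<Rightarrow> real \<Rightarrow> real" where
  "flat m t = (if t \<le> 0 then 0 else (1 / t) ^ m * exp (- (1 / t)))"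

lemma flat_nonneg: "0 \<le> flat m t"
  by (simp add: flat_def)

lemma flat_0_le_1: "flat 0 t \<le> 1"
  by (simp add: flat_def)

text \<open>
Writing \<open>x = 1 / t\<close>, this is \<open>x\<^sup>n \<le> n! exp x\<close> for \<open>n = m + 2\<close>. Quadratic decay is what
makes the derivative at the origin vanish.
\<close>

lemma flat_le_square: "flat m t \<le> fact (m + 2) * t\<^sup>2"
proof (cases "t \<le> 0")
  case False
  define x where "x = 1 / t"
  have x: "x > 0" and t: "t = 1 / x" using False by (auto simp: x_def)
  have "(\<Sum>n\<in>{m + 2}. x ^ n /\<^sub>R fact n) \<le> (\<Sum>n. x ^ n /\<^sub>R fact n)"
    using x by (intro sum_le_suminf sums_summable[OF exp_converges]) auto
  then have "x ^ (m + 2) \<le> fact (m + 2) * exp x"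
    by (simp add: exp_def divide_simps mult.commute)
  then have "x ^ m * x\<^sup>2 * exp (- x) \<le> fact (m + 2)"
    by (simp add: exp_minus divide_simps power_add power2_eq_square mult_ac)
  then have "x ^ m * exp (- x) \<le> fact (m + 2) * t\<^sup>2"
    unfolding t using x by (simp add: divide_simps mult_ac)
  then show ?thesis
    using False by (simp add: flat_def x_def)
qed (simp add: flat_def)

lemma flat_has_real_derivative:
  "(flat m has_real_derivative (flat (m + 2) t - of_nat m * flat (m + 1) t)) (at t)"
proof -
  consider "t < 0" | "t = 0" | "t > 0" by linarith
  then show ?thesis
  proof cases
    case 1
    have "((\<lambda>_. 0) has_real_derivative 0) (at t)" by simp
    then have "(flat m has_real_derivative 0) (at t)"
      by (rule has_field_derivative_transform_within_open[where S = "{..<0}"])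
         (use 1 in \<open>auto simp: flat_def\<close>)
    then show ?thesis using 1 by (simp add: flat_def)
  next
    case 2
    have "((\<lambda>y. (flat m y - flat m 0) / (y - 0)) \<longlongrightarrow> 0) (at 0)"
    proof (rule tendsto_0_le[where K = 1])
      show "((\<lambda>y::real. fact (m + 2) * \<bar>y\<bar>) \<longlongrightarrow> 0) (at 0)"
        by (intro tendsto_mult_right_zero tendsto_rabs_zero tendsto_ident_at)
      have "\<bar>flat m y / y\<bar> \<le> fact (m + 2) * \<bar>y\<bar>" if "y \<noteq> 0" for y
      proof -
        have "\<bar>flat m y / y\<bar> = flat m y / \<bar>y\<bar>"
          using flat_nonneg[of m y] by (simp add: abs_divide)
        also have "\<dots> \<le> (fact (m + 2) * \<bar>y\<bar>\<^sup>2) / \<bar>y\<bar>"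
          using flat_le_square[of m y] by (intro divide_right_mono) auto
        also have "\<dots> = fact (m + 2) * \<bar>y\<bar>" using that by (simp add: power2_eq_square del: abs_mult_self_eq power2_abs)
        finally show ?thesis .
      qed
      then show "\<forall>\<^sub>F y in at 0. norm ((flat m y - flat m 0) / (y - 0)) \<le> norm (fact (m + 2) * \<bar>y\<bar>) * 1"
        by (auto simp: eventually_at_filter flat_def[of m 0])
    qed
    then show ?thesis using 2 by (simp add: has_field_derivative_iff flat_def)
  next
    case 3
    have inv: "((\<lambda>t. 1 / t) has_real_derivative - ((1 / t)\<^sup>2)) (at t)"
      using 3 by (auto intro!: derivative_eq_intros simp: power2_eq_square)
    have "real m * (- (y\<^sup>2) * y ^ (m - 1)) * E + E * - (- (y\<^sup>2)) * y ^ m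
        = y ^ (m + 2) * E - real m * (y ^ (m + 1) * E)" for y E :: real
      by (cases m) (simp_all add: power2_eq_square algebra_simps)
    from this[of "1 / t" "exp (- (1 / t))"]
    have "real m * (- ((1 / t)\<^sup>2) * (1 / t) ^ (m - 1)) * exp (- (1 / t))
          + exp (- (1 / t)) * - (- ((1 / t)\<^sup>2)) * (1 / t) ^ m
        = flat (m + 2) t - of_nat m * flat (m + 1) t"
      using 3 unfolding flat_def by simp
    with DERIV_mult[OF DERIV_power[OF inv, of m] DERIV_fun_exp[OF DERIV_minus[OF inv]]]
    have "((\<lambda>t. (1 / t) ^ m * exp (- (1 / t))) has_real_derivative
            (flat (m + 2) t - of_nat m * flat (m + 1) t)) (at t)" by simp
    then show ?thesis
      by (rule has_field_derivative_transform_within_open[where S = "{0<..}"])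
         (use 3 in \<open>auto simp: flat_def\<close>)
  qed
qed

text \<open>
Smoothness is proved for a whole set of functions that taking a directional derivative maps into
itself: one induction on \<open>k\<close> then gives every \<open>C_k\<close>. The set contains the products used below.
\<close>

inductive_set flat_algebra :: "('a::euclidean_space \<Rightarrow> complex) set" where
  const: "(\<lambda>x. c) \<in> flat_algebra"
| flat: "(\<lambda>x. complex_of_real (flat m (x \<bullet> v + s))) \<in> flat_algebra"
| add: "f \<in> flat_algebra \<Longrightarrow> g \<in> flat_algebra \<Longrightarrow> (\<lambda>x. f x + g x) \<in> flat_algebra"
| mult: "f \<in> flat_algebra \<Longrightarrow> g \<in> flat_algebra \<Longrightarrow> (\<lambda>x. f x * g x) \<in> flat_algebra"

lemma flat_algebra_derivative:
  assumes "f \<in> flat_algebra"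
  shows "\<exists>f'. (\<forall>x. (f has_derivative f' x) (at x)) \<and> (\<forall>v. (\<lambda>x. f' x v) \<in> flat_algebra)"
  using assms
proof induction
  case (const c)
  have "\<forall>x. ((\<lambda>x::'a. c) has_derivative (\<lambda>_. 0)) (at x)" by simp
  then show ?case by (intro exI[of _ "\<lambda>_ _. 0"]) (auto intro: flat_algebra.const)
next
  case (flat m v s)
  let ?D = "\<lambda>x w. complex_of_real (flat (m + 2) (x \<bullet> v + s)) * of_real (w \<bullet> v)
               + complex_of_real (flat (m + 1) (x \<bullet> v + s)) * of_real (- real m * (w \<bullet> v))"
  have "((\<lambda>x. complex_of_real (flat m (x \<bullet> v + s))) has_derivative ?D x) (at x)" for x
  proof -
    have "((\<lambda>x. x \<bullet> v + s) has_derivative (\<lambda>w. w \<bullet> v)) (at x)"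
      by (auto intro!: derivative_eq_intros)
    from has_derivative_compose[OF this flat_has_real_derivative[of m, unfolded has_field_derivative_def]]
    have "((\<lambda>x. flat m (x \<bullet> v + s)) has_derivative
        (\<lambda>w. (flat (m + 2) (x \<bullet> v + s) - real m * flat (m + 1) (x \<bullet> v + s)) * (w \<bullet> v))) (at x)" .
    then have "((\<lambda>x. complex_of_real (flat m (x \<bullet> v + s))) has_derivative
        (\<lambda>w. of_real ((flat (m + 2) (x \<bullet> v + s) - real m * flat (m + 1) (x \<bullet> v + s)) * (w \<bullet> v)))) (at x)"
      by (rule has_derivative_of_real)
    then show ?thesis
      by (rule has_derivative_eq_rhs) (auto simp: algebra_simps)
  qed
  moreover have "(\<lambda>x. ?D x w) \<in> flat_algebra" for w
    by (intro flat_algebra.intros)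
  ultimately show ?case by (intro exI[of _ ?D]) blast
next
  case (add f g)
  then obtain f' g' where "\<forall>x. (f has_derivative f' x) (at x)" "\<forall>v. (\<lambda>x. f' x v) \<in> flat_algebra"
    "\<forall>x. (g has_derivative g' x) (at x)" "\<forall>v. (\<lambda>x. g' x v) \<in> flat_algebra" by blast
  then show ?case
    by (intro exI[of _ "\<lambda>x v. f' x v + g' x v"]) (auto intro!: has_derivative_add flat_algebra.add)
next
  case (mult f g)
  then obtain f' g' where "\<forall>x. (f has_derivative f' x) (at x)" "\<forall>v. (\<lambda>x. f' x v) \<in> flat_algebra"
    "\<forall>x. (g has_derivative g' x) (at x)" "\<forall>v. (\<lambda>x. g' x v) \<in> flat_algebra" by blast
  then show ?case using mult
    by (intro exI[of _ "\<lambda>x v. f x * g' x v + f' x v * g x"])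
       (auto intro!: has_derivative_mult flat_algebra.add flat_algebra.mult)
qed

lemma flat_algebra_C_k:
  assumes "f \<in> flat_algebra"
  shows "C_k k f"
  using assms
proof (induction k arbitrary: f)
  case 0
  then obtain f' where "\<forall>x. (f has_derivative f' x) (at x)"
    using flat_algebra_derivative by blast
  then show ?case
    by (auto intro!: continuous_at_imp_continuous_on dest: has_derivative_continuous)
next
  case (Suc k)
  obtain f' where f': "\<And>x. (f has_derivative f' x) (at x)" "\<And>v. (\<lambda>x. f' x v) \<in> flat_algebra"
    using flat_algebra_derivative[OF Suc.prems] by blast
  have "frechet_derivative f (at x) = f' x" for x
    using frechet_derivative_at[OF f'(1)] by simp
  then show ?case using f' Suc.IH
    by (auto simp: differentiable_on_def differentiable_def)
qed

lemma flat_algebra_prod: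
  assumes "\<And>i. i \<in> A \<Longrightarrow> f i \<in> flat_algebra"
  shows "(\<lambda>x. \<Prod>i\<in>A. f i x) \<in> flat_algebra"
  using assms by (induction A rule: infinite_finite_induct) (auto intro: flat_algebra.intros)

text \<open>
As \<open>n\<close> grows this tends to the indicator function of \<open>box a d\<close>, since \<open>exp (- 1 / (n t))\<close> tends
to 1 for \<open>t > 0\<close>. The bound \<open>norm_box_bump_le_1\<close> gives dominated convergence.
\<close>

definition box_bump :: "real \<Rightarrow> 'a::euclidean_space \<Rightarrow> 'a \<Rightarrow> 'a \<Rightarrow> complex" where
  "box_bump n a d x = (\<Prod>b\<in>Basis. complex_of_real (flat 0 (n * (x \<bullet> b - a \<bullet> b)))
      * complex_of_real (flat 0 (n * (d \<bullet> b - x \<bullet> b))))"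

lemma smooth_box_bump: "smooth (box_bump n a d)"
proof -
  have "(\<lambda>x::'a. complex_of_real (flat 0 (n * (x \<bullet> b - a \<bullet> b)))) \<in> flat_algebra" for b
    using flat_algebra.flat[of 0 "n *\<^sub>R b" "- n * (a \<bullet> b)"] by (simp add: algebra_simps)
  moreover have "(\<lambda>x::'a. complex_of_real (flat 0 (n * (d \<bullet> b - x \<bullet> b)))) \<in> flat_algebra" for b
    using flat_algebra.flat[of 0 "- n *\<^sub>R b" "n * (d \<bullet> b)"] by (simp add: algebra_simps)
  ultimately have "box_bump n a d \<in> flat_algebra"
    unfolding box_bump_def[abs_def] by (intro flat_algebra_prod flat_algebra.mult)
  then show ?thesis
    unfolding smooth_def by (blast intro: flat_algebra_C_k)
qed

lemma box_bump_eq_0: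
  assumes "n > 0" "x \<notin> box a d"
  shows "box_bump n a d x = 0"
proof -
  obtain b where "b \<in> Basis" "x \<bullet> b \<le> a \<bullet> b \<or> d \<bullet> b \<le> x \<bullet> b"
    using assms(2) by (auto simp: mem_box not_less)
  then have "flat 0 (n * (x \<bullet> b - a \<bullet> b)) = 0 \<or> flat 0 (n * (d \<bullet> b - x \<bullet> b)) = 0"
    using assms(1) by (auto simp: flat_def mult_le_0_iff)
  with \<open>b \<in> Basis\<close> show ?thesis
    unfolding box_bump_def by (auto intro!: prod_zero bexI[of _ b])
qed

lemma norm_box_bump_le_1: "cmod (box_bump n a d x) \<le> 1"
  unfolding box_bump_def prod_norm[symmetric]
  by (rule prod_le_1) (auto simp: norm_mult flat_nonneg intro!: mult_le_one flat_0_le_1)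

lemma box_bump_test_fun:
  assumes "n > 0" "cbox a d \<subseteq> \<Omega>"
  shows "box_bump n a d \<in> test_fun \<Omega>"
  unfolding test_fun_def
  using assms smooth_box_bump box_bump_eq_0[OF assms(1)] box_subset_cbox
  by (fastforce intro!: exI[of _ "cbox a d"])

lemma box_bump_tendsto_indicator:
  "(\<lambda>n. box_bump (real (Suc n)) a d x) \<longlonglongrightarrow> indicator (box a d) x"
proof (cases "x \<in> box a d")
  case True
  have lim: "(\<lambda>n. flat 0 (real (Suc n) * t)) \<longlonglongrightarrow> 1" if "t > 0" for t
  proof -
    have "(\<lambda>n. exp (- ((1 / t) * inverse (real (Suc n))))) \<longlonglongrightarrow> exp (- ((1 / t) * 0))"
      by (intro tendsto_intros LIMSEQ_inverse_real_of_nat)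
    moreover have "flat 0 (real (Suc n) * t) = exp (- ((1 / t) * inverse (real (Suc n))))" for n
    proof -
      have "real (Suc n) * t > 0" using that by simp
      then show ?thesis by (simp add: flat_def divide_inverse mult.commute)
    qed
    ultimately show ?thesis by simp
  qed
  have "(\<lambda>n. box_bump (real (Suc n)) a d x) \<longlonglongrightarrow>
      (\<Prod>b\<in>(Basis::'a set). complex_of_real 1 * complex_of_real 1)"
    unfolding box_bump_def
    by (intro tendsto_prod tendsto_mult tendsto_of_real lim) (use True in \<open>auto simp: mem_box\<close>)
  with True show ?thesis by simp
next
  case False
  then show ?thesis by (simp add: box_bump_eq_0)
qed

section \<open>The fundamental lemma of the calculus of variations\<close>

lemma sigma_finite_lebesgue_on:
  fixes \<Omega> :: "'a::euclidean_space set"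
  assumes "\<Omega> \<in> sets lebesgue"
  shows "sigma_finite_measure (lebesgue_on \<Omega>)"
proof (rule sigma_finite_measure_restrict_space[OF _ assms])
  obtain A :: "'a set set" where A: "countable A" "A \<subseteq> sets lborel" "\<Union>A = space lborel"
    "\<forall>a\<in>A. emeasure lborel a \<noteq> \<infinity>"
    using sigma_finite_measure.sigma_finite_countable[OF sigma_finite_lborel] by blast
  have "\<forall>a\<in>A. emeasure lebesgue a \<noteq> \<infinity>" using A(2,4) by (auto simp: subset_iff)
  moreover have "A \<subseteq> sets lebesgue" "\<Union>A = space (lebesgue :: 'a measure)" using A(2,3) by auto
  ultimately have "countable A \<and> A \<subseteq> sets lebesgue \<and> \<Union>A = space (lebesgue :: 'a measure)
      \<and> (\<forall>a\<in>A. emeasure lebesgue a \<noteq> \<infinity>)"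
    using A(1) by (intro conjI)
  then show "sigma_finite_measure (lebesgue :: 'a measure)"
    by (rule sigma_finite_measure.intro[OF exI[of _ A]])
qed

lemma cbox_integrable_L2:
  assumes "open \<Omega>" "w \<in> L2 \<Omega>"
  shows "integrable (lebesgue_on \<Omega>) (\<lambda>x. indicat_real (cbox a d) x *\<^sub>R w x)"
proof (rule Bochner_Integration.integrable_bound)
  have \<Omega>: "\<Omega> \<in> sets lebesgue" using assms(1) by simp
  have "integrable (lebesgue_on \<Omega>) (indicat_real (cbox a d))"
  proof (subst integrable_restrict_space)
    have "emeasure lborel (\<Omega> \<inter> cbox a d) \<le> emeasure lborel (cbox a d)"
      by (intro emeasure_mono) auto
    also have "\<dots> < \<infinity>" using emeasure_lborel_cbox_finite[of a d] by simp
    finally show "integrable lebesgue (\<lambda>x. indicator \<Omega> x *\<^sub>R indicat_real (cbox a d) x)"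
      using assms(1) by (simp add: indicator_inter_arith[symmetric])
  qed (use \<Omega> in simp)
  then show "integrable (lebesgue_on \<Omega>) (\<lambda>x. indicat_real (cbox a d) x + (cmod (w x))\<^sup>2)"
    using assms(2) by (intro Bochner_Integration.integrable_add) (auto simp: L2_def)
  have "indicat_real (cbox a d) \<in> borel_measurable (lebesgue_on \<Omega>)"
    by (intro measurable_restrict_space1 borel_measurable_indicator) simp
  then show "(\<lambda>x. indicat_real (cbox a d) x *\<^sub>R w x) \<in> borel_measurable (lebesgue_on \<Omega>)"
    using assms(2) by (intro borel_measurable_scaleR) (auto simp: L2_def)
  have "r \<le> 1 + r\<^sup>2" for r :: real
  proof -
    have "0 \<le> (r - 1 / 2)\<^sup>2 + 3 / 4" by (intro add_nonneg_nonneg zero_le_power2) simp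
    then show ?thesis by (simp add: power2_eq_square algebra_simps)
  qed
  then show "AE x in lebesgue_on \<Omega>. norm (indicat_real (cbox a d) x *\<^sub>R w x)
      \<le> norm (indicat_real (cbox a d) x + (cmod (w x))\<^sup>2)"
    by (intro AE_I2) (simp add: indicator_def)
qed

text \<open>
Testing against the bumps of the box and passing to the limit by dominated convergence; the
majorant is \<open>|w|\<close> on the closed box, which is integrable because the box has finite measure.
\<close>

lemma box_integral_eq_0:
  assumes "open \<Omega>" "w \<in> L2 \<Omega>"
    and orth: "\<And>\<phi>. \<phi> \<in> test_fun \<Omega> \<Longrightarrow> (\<integral>x. w x * \<phi> x \<partial>lebesgue_on \<Omega>) = 0"
    and "cbox a d \<subseteq> \<Omega>"
  shows "set_lebesgue_integral (lebesgue_on \<Omega>) (box a d) w = 0"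
proof -
  let ?M = "lebesgue_on \<Omega>" and ?\<phi> = "\<lambda>n. box_bump (real (Suc n)) a d"
  have wm: "w \<in> borel_measurable ?M" using assms(2) by (simp add: L2_def)
  have meas: "?\<phi> n \<in> borel_measurable ?M" for n
  proof -
    have "continuous_on UNIV (?\<phi> n)"
      using smooth_box_bump[of "real (Suc n)" a d] unfolding smooth_def by (metis C_k.simps(1))
    then show ?thesis
      by (intro measurable_restrict_space1 measurable_completion) (simp add: borel_measurable_continuous_onI)
  qed
  have "(\<lambda>n. \<integral>x. w x * ?\<phi> n x \<partial>?M) \<longlonglongrightarrow> (\<integral>x. indicat_real (box a d) x *\<^sub>R w x \<partial>?M)"
  proof (rule integral_dominated_convergence)
    show "(\<lambda>x. indicat_real (box a d) x *\<^sub>R w x) \<in> borel_measurable ?M"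
      by (intro borel_measurable_scaleR wm measurable_restrict_space1 borel_measurable_indicator) simp
    show "(\<lambda>x. w x * ?\<phi> n x) \<in> borel_measurable ?M" for n
      by (intro borel_measurable_times wm meas)
    show "integrable ?M (\<lambda>x. norm (indicat_real (cbox a d) x *\<^sub>R w x))"
      by (intro integrable_norm cbox_integrable_L2 assms)
    have "(\<lambda>n. w x * ?\<phi> n x) \<longlonglongrightarrow> indicat_real (box a d) x *\<^sub>R w x" for x
    proof -
      have "w x * indicator (box a d) x = indicat_real (box a d) x *\<^sub>R w x"
        by (cases "x \<in> box a d") simp_all
      then show ?thesis
        using tendsto_mult_left[OF box_bump_tendsto_indicator, of "w x" a d x] by metis
    qed
    then show "AE x in ?M. (\<lambda>n. w x * ?\<phi> n x) \<longlonglongrightarrow> indicat_real (box a d) x *\<^sub>R w x"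
      by (rule AE_I2)
    have "norm (w x * ?\<phi> n x) \<le> norm (indicat_real (cbox a d) x *\<^sub>R w x)" for n x
    proof (cases "x \<in> box a d")
      case True
      then have "x \<in> cbox a d" using box_subset_cbox by blast
      then show ?thesis
        using norm_box_bump_le_1[of "real (Suc n)" a d x]
        by (simp add: norm_mult mult_left_le)
    qed (simp add: box_bump_eq_0)
    then show "AE x in ?M. norm (w x * ?\<phi> n x) \<le> norm (indicat_real (cbox a d) x *\<^sub>R w x)" for n
      by (intro AE_I2)
  qed
  moreover have "(\<integral>x. w x * ?\<phi> n x \<partial>?M) = 0" for n
    by (intro orth box_bump_test_fun assms) simp
  ultimately show ?thesis
    by (simp add: set_lebesgue_integral_def LIMSEQ_const_iff)
qed

text \<open>
Boxes are closed under intersection and generate the Borel sets, and the sets on which the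
integral vanishes are closed under complements and disjoint unions.
\<close>

lemma borel_integral_eq_0:
  assumes "open \<Omega>" "w \<in> L2 \<Omega>"
    and "\<And>\<phi>. \<phi> \<in> test_fun \<Omega> \<Longrightarrow> (\<integral>x. w x * \<phi> x \<partial>lebesgue_on \<Omega>) = 0"
    and sub: "cbox a d \<subseteq> \<Omega>" and "A \<in> sets borel"
  shows "set_lebesgue_integral (lebesgue_on \<Omega>) (A \<inter> box a d) w = 0"
proof -
  let ?M = "lebesgue_on \<Omega>" and ?E = "range (\<lambda>(p, q). box p q::'a set)"
  have B: "box a d \<subseteq> \<Omega>" using sub box_subset_cbox by blast
  have sets: "X \<inter> box a d \<in> sets ?M" if "X \<in> sets borel" for X
  proof -
    have "X \<in> sets lebesgue" using that by (metis sets_completionI_sets sets_lborel)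
    moreover have "X \<inter> box a d = \<Omega> \<inter> (X \<inter> box a d)" using B by blast
    ultimately show ?thesis unfolding sets_restrict_space by (metis image_eqI sets.Int lmeasurable_box fmeasurableD)
  qed
  have int: "set_integrable ?M (X \<inter> box a d) w" if "X \<in> sets borel" for X
  proof -
    have "set_integrable ?M (X \<inter> box a d) (\<lambda>x. indicat_real (cbox a d) x *\<^sub>R w x)"
      unfolding set_integrable_def
      by (intro integrable_mult_indicator sets that cbox_integrable_L2 assms)
    moreover have "(\<lambda>x. indicat_real (X \<inter> box a d) x *\<^sub>R indicat_real (cbox a d) x *\<^sub>R w x)
        = (\<lambda>x. indicat_real (X \<inter> box a d) x *\<^sub>R w x)"
      using box_subset_cbox[of a d] by (auto simp: indicator_def fun_eq_iff)
    ultimately show ?thesis by (simp add: set_integrable_def)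
  qed
  have "Int_stable ?E" by (auto simp: Int_stable_def box_Int_box)
  moreover have "?E \<subseteq> Pow UNIV" by simp
  moreover have "A \<in> sigma_sets UNIV ?E" using assms(5) by (simp add: borel_eq_box)
  ultimately show ?thesis
  proof (induction rule: sigma_sets_induct_disjoint)
    case (basic X)
    then obtain p q where X: "X = box p q" by auto
    obtain r s where rs: "X \<inter> box a d = box r s" unfolding X box_Int_box by blast
    show ?case
    proof (cases "box r s = {}")
      case False
      have "box r s \<subseteq> box a d" using rs by blast
      then have "closure (box r s) \<subseteq> closure (box a d)" by (rule closure_mono)
      also have "\<dots> \<subseteq> cbox a d" by (intro closure_minimal box_subset_cbox closed_cbox)
      finally have "cbox r s \<subseteq> \<Omega>" using False sub by (simp add: closure_box)
      then show ?thesis unfolding rs by (intro box_integral_eq_0 assms)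
    qed (simp add: rs set_lebesgue_integral_def)
  next
    case empty
    show ?case by (simp add: set_lebesgue_integral_def)
  next
    case (compl X)
    then have X: "X \<in> sets borel" by (simp add: borel_eq_box)
    have "box a d = (X \<inter> box a d) \<union> ((UNIV - X) \<inter> box a d)" by blast
    then have "set_lebesgue_integral ?M (box a d) w =
        set_lebesgue_integral ?M (X \<inter> box a d) w + set_lebesgue_integral ?M ((UNIV - X) \<inter> box a d) w"
      using set_integral_Un[of "X \<inter> box a d" "(UNIV - X) \<inter> box a d" ?M w] int X by auto
    then show ?case
      using box_integral_eq_0[OF assms(1-4)] compl by simp
  next
    case (union X)
    then have X: "X i \<in> sets borel" for i by (auto simp: borel_eq_box)
    have "set_lebesgue_integral ?M (\<Union>i. X i \<inter> box a d) w
        = (\<Sum>i. set_lebesgue_integral ?M (X i \<inter> box a d) w)"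
    proof (rule lebesgue_integral_countable_add)
      show "X i \<inter> box a d \<in> sets ?M" for i by (intro sets X)
      show "(X i \<inter> box a d) \<inter> (X j \<inter> box a d) = {}" if "i \<noteq> j" for i j
        using union(1) that by (auto simp: disjoint_family_on_def)
      show "set_integrable ?M (\<Union>i. X i \<inter> box a d) w"
        using int[of "\<Union>i. X i"] X by (simp add: Int_commute)
    qed
    then show ?case using union by simp
  qed
qed

text \<open>
A function whose integral over every measurable set vanishes is zero almost everywhere. The
Lebesgue measurable sets differ from Borel sets by subsets of null sets only.
\<close>

lemma AE_box_eq_0:
  assumes "open \<Omega>" "w \<in> L2 \<Omega>"
    and "\<And>\<phi>. \<phi> \<in> test_fun \<Omega> \<Longrightarrow> (\<integral>x. w x * \<phi> x \<partial>lebesgue_on \<Omega>) = 0"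
    and sub: "cbox a d \<subseteq> \<Omega>"
  shows "AE x in lebesgue_on \<Omega>. x \<in> box a d \<longrightarrow> w x = 0"
proof -
  let ?M = "lebesgue_on \<Omega>" and ?f = "\<lambda>x. indicat_real (cbox a d) x *\<^sub>R w x"
  have \<Omega>: "\<Omega> \<in> sets lebesgue" using assms(1) by simp
  have "AE x in ?M. indicat_real (box a d) x *\<^sub>R ?f x = 0"
  proof (rule sigma_finite_measure.density_zero[OF sigma_finite_lebesgue_on[OF \<Omega>]])
    have bm: "box a d \<in> sets ?M"
    proof -
      have "box a d \<subseteq> \<Omega>" using sub box_subset_cbox by (rule subset_trans[rotated])
      then show ?thesis using \<Omega> by (simp add: sets_restrict_space_iff)
    qed
    show "integrable ?M (\<lambda>x. indicat_real (box a d) x *\<^sub>R ?f x)"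
      by (intro integrable_mult_indicator bm cbox_integrable_L2 assms)
    fix A assume A: "A \<in> sets ?M"
    then have AL: "A \<in> sets lebesgue" using \<Omega> by (simp add: sets_restrict_space_iff)
    then obtain S N N' where S: "A = S \<union> N" "N \<subseteq> N'" "N' \<in> null_sets lborel" "S \<in> sets lborel"
      by (rule sets_completionE)
    have "AE x in lebesgue. x \<notin> N'"
      using S(3) by (intro AE_not_in null_sets_completionI)
    then have "AE x in lebesgue. x \<in> \<Omega> \<longrightarrow> x \<notin> N'" by eventually_elim blast
    moreover have "\<Omega> \<inter> space lebesgue \<in> sets lebesgue" using \<Omega> by simp
    ultimately have AE: "AE x in ?M. x \<notin> N'"
      using AE_restrict_space_iff by blast
    have "set_lebesgue_integral ?M A (\<lambda>x. indicat_real (box a d) x *\<^sub>R ?f x)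
        = set_lebesgue_integral ?M (S \<inter> box a d) w"
      unfolding set_lebesgue_integral_def
    proof (rule integral_cong_AE)
      have wm: "w \<in> borel_measurable ?M" using assms(2) by (simp add: L2_def)
      have cm: "indicat_real X \<in> borel_measurable ?M" if "X \<in> sets lebesgue" for X
        using that by (intro measurable_restrict_space1 borel_measurable_indicator)
      show "(\<lambda>x. indicat_real A x *\<^sub>R indicat_real (box a d) x *\<^sub>R ?f x) \<in> borel_measurable ?M"
        by (intro borel_measurable_scaleR wm cm AL) auto
      show "(\<lambda>x. indicat_real (S \<inter> box a d) x *\<^sub>R w x) \<in> borel_measurable ?M"
        using S(4) by (intro borel_measurable_scaleR wm cm) auto
      show "AE x in ?M. indicat_real A x *\<^sub>R indicat_real (box a d) x *\<^sub>R ?f x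
          = indicat_real (S \<inter> box a d) x *\<^sub>R w x"
        using AE
      proof eventually_elim
        case (elim x)
        then have "x \<in> A \<longleftrightarrow> x \<in> S" using S(1,2) by blast
        then show ?case using box_subset_cbox[of a d] by (auto simp: indicator_def)
      qed
    qed
    moreover have "S \<in> sets borel" using S(4) by (metis sets_lborel)
    then have "set_lebesgue_integral ?M (S \<inter> box a d) w = 0"
      by (intro borel_integral_eq_0 assms)
    ultimately show "set_lebesgue_integral ?M A (\<lambda>x. indicat_real (box a d) x *\<^sub>R ?f x) = 0"
      by simp
  qed
  then show ?thesis
  proof eventually_elim
    case (elim x)
    then show ?case using box_subset_cbox[of a d] by (auto simp: indicator_def)
  qed
qed

text \<open>
An open set is a countable union of boxes whose closures it contains, so the local statement is
enough.
\<close>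

theorem fundamental_lemma_L2:
  assumes "open \<Omega>" "w \<in> L2 \<Omega>"
    and "\<And>\<phi>. \<phi> \<in> test_fun \<Omega> \<Longrightarrow> (\<integral>x. w x * \<phi> x \<partial>lebesgue_on \<Omega>) = 0"
  shows "AE x in lebesgue_on \<Omega>. w x = 0"
proof -
  let ?F = "{box a d |a d. cbox a d \<subseteq> \<Omega>}"
  have "\<Omega> \<subseteq> \<Union> ?F"
  proof
    fix x assume "x \<in> \<Omega>"
    then obtain e where e: "e > 0" "cball x e \<subseteq> \<Omega>"
      using assms(1) by (meson open_contains_cball)
    obtain a d where ad: "x \<in> box a d" "box a d \<subseteq> ball x e"
      using rational_boxes[OF e(1), of x] by blast
    have "cbox a d = closure (box a d)" using ad(1) by (metis closure_box empty_iff)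
    also have "\<dots> \<subseteq> cball x e" using ad(2) ball_subset_cball by (intro closure_minimal) blast+
    finally show "x \<in> \<Union> ?F" using e(2) ad(1) by blast
  qed
  moreover obtain F' where F': "F' \<subseteq> ?F" "countable F'" "\<Union> F' = \<Union> ?F"
    by (rule Lindelof[of ?F]) (auto simp: open_box)
  ultimately have cover: "\<Omega> \<subseteq> \<Union> F'" by simp
  have "AE x in lebesgue_on \<Omega>. \<forall>X\<in>F'. x \<in> X \<longrightarrow> w x = 0"
    unfolding AE_ball_countable[OF F'(2)]
  proof
    fix X assume "X \<in> F'"
    then obtain a d where "X = box a d" "cbox a d \<subseteq> \<Omega>" using F'(1) by blast
    then show "AE x in lebesgue_on \<Omega>. x \<in> X \<longrightarrow> w x = 0"
      using AE_box_eq_0[OF assms] by simp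
  qed
  moreover have "AE x in lebesgue_on \<Omega>. x \<in> \<Omega>"
    using AE_space[of "lebesgue_on \<Omega>"] by simp
  ultimately show ?thesis
    by eventually_elim (use cover in blast)
qed

section \<open>Derivatives of compactly supported functions\<close>

lemma smooth_differentiable: "smooth \<phi> \<Longrightarrow> (\<phi> has_derivative frechet_derivative \<phi> (at x)) (at x)"
  unfolding smooth_def
  by (metis C_k.simps(2) UNIV_I differentiable_on_def frechet_derivative_works)

lemma smooth_continuous: "smooth \<phi> \<Longrightarrow> continuous_on UNIV \<phi>"
  unfolding smooth_def by (metis C_k.simps(1))

lemma smooth_continuous_pderiv:
  "smooth \<phi> \<Longrightarrow> continuous_on UNIV (\<lambda>x. frechet_derivative \<phi> (at x) b)"
  unfolding smooth_def by (metis C_k.simps)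

lemma C_k_cmult:
  fixes f :: "'a::euclidean_space \<Rightarrow> complex"
  shows "C_k k f \<Longrightarrow> C_k k (\<lambda>x. c * f x)"
proof (induction k arbitrary: f)
  case 0
  then show ?case by (auto intro: continuous_intros)
next
  case (Suc k)
  have D: "((\<lambda>x. c * f x) has_derivative (\<lambda>v. c * frechet_derivative f (at x) v)) (at x)" for x
    using Suc.prems unfolding C_k.simps
    by (intro has_derivative_mult_right) (metis UNIV_I differentiable_on_def frechet_derivative_works)
  then have "frechet_derivative (\<lambda>x. c * f x) (at x) = (\<lambda>v. c * frechet_derivative f (at x) v)" for x
    by (metis frechet_derivative_at)
  then show ?case using Suc D
    by (auto simp: differentiable_on_def differentiable_def)
qed

lemma compact_support_integrable:
  fixes f :: "'a::euclidean_space \<Rightarrow> 'b::{banach, second_countable_topology}"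
  assumes "continuous_on UNIV f" "compact C" "\<And>x. x \<notin> C \<Longrightarrow> f x = 0"
  shows "integrable lborel f"
proof -
  have "integrable lborel (\<lambda>x. indicator C x *\<^sub>R f x)"
    using assms by (intro borel_integrable_compact) (auto intro: continuous_on_subset)
  moreover have "(\<lambda>x. indicator C x *\<^sub>R f x) = f"
    using assms(3) by (auto simp: indicator_def)
  ultimately show ?thesis by simp
qed

lemma restrict_integral_to_support:
  fixes f :: "'a::euclidean_space \<Rightarrow> 'b::{banach, second_countable_topology}"
  assumes "open \<Omega>" "continuous_on UNIV f" "\<And>x. x \<notin> \<Omega> \<Longrightarrow> f x = 0"
  shows "integrable (lebesgue_on \<Omega>) f \<longleftrightarrow> integrable lborel f"
    and "integral\<^sup>L (lebesgue_on \<Omega>) f = integral\<^sup>L lborel f"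
proof -
  have "f \<in> borel_measurable lborel" using assms(2) by (simp add: borel_measurable_continuous_onI)
  moreover have "(\<lambda>x. indicator \<Omega> x *\<^sub>R f x) = f"
    using assms(3) by (auto simp: indicator_def)
  ultimately show "integrable (lebesgue_on \<Omega>) f \<longleftrightarrow> integrable lborel f"
    "integral\<^sup>L (lebesgue_on \<Omega>) f = integral\<^sup>L lborel f"
    using assms(1) by (simp_all add: integrable_restrict_space integral_restrict_space
        integrable_completion integral_completion)
qed

text \<open>
The difference quotients of \<open>F\<close> in the direction \<open>b\<close> have integral zero, as Lebesgue measure is
translation invariant; by the mean value theorem they are uniformly bounded, and they live on a
common bounded set, so their integrals converge to that of the derivative.
\<close>

lemma integral_directional_derivative_eq_0:
  fixes F :: "'a::euclidean_space \<Rightarrow> complex"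
  assumes F: "\<And>x. (F has_derivative F' x) (at x)"
    and cont: "continuous_on UNIV (\<lambda>x. F' x b)"
    and C: "compact C" "\<And>x. x \<notin> C \<Longrightarrow> F x = 0" "\<And>x. x \<notin> C \<Longrightarrow> F' x b = 0"
  shows "(\<integral>x. F' x b \<partial>lborel) = 0"
proof -
  \<comment> \<open>Steps of length at most 1, so that the shifted supports stay in one ball.\<close>
  define h where "h n = inverse (real (Suc n))" for n
  define g where "g n x = (F (h n *\<^sub>R b + x) - F x) /\<^sub>R h n" for n x
  have h: "0 < h n" "h n \<le> 1" for n by (simp_all add: h_def inverse_le_1_iff)
  have contF: "continuous_on UNIV F"
    using F by (auto intro!: continuous_at_imp_continuous_on has_derivative_continuous)
  then have Fm: "F \<in> borel_measurable lborel" by (simp add: borel_measurable_continuous_onI)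
  have Fint: "integrable lborel F" by (rule compact_support_integrable[OF contF C(1,2)])
  have shift: "integrable lborel (\<lambda>x. F (v + x))" "(\<integral>x. F (v + x) \<partial>lborel) = (\<integral>x. F x \<partial>lborel)" for v
  proof -
    have "(+) v \<in> measurable lborel borel" by simp
    then show "integrable lborel (\<lambda>x. F (v + x))" "(\<integral>x. F (v + x) \<partial>lborel) = (\<integral>x. F x \<partial>lborel)"
      using Fint Fm integrable_distr_eq[of "(+) v" lborel borel F] integral_distr[of "(+) v" lborel borel F]
      by (simp_all add: lborel_distr_plus)
  qed
  have g0: "(\<integral>x. g n x \<partial>lborel) = 0" for n
    unfolding g_def using shift Fint by simp
  obtain L where L: "\<And>x. norm (F' x b) \<le> L" "0 \<le> L"
  proof -
    have "bounded ((\<lambda>x. F' x b) ` C)"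
      using cont C(1) by (intro compact_imp_bounded compact_continuous_image) (auto intro: continuous_on_subset)
    then obtain L where L: "L > 0" "\<And>x. x \<in> C \<Longrightarrow> norm (F' x b) \<le> L"
      by (auto simp: bounded_pos)
    then have "norm (F' x b) \<le> L" for x using C(3)[of x] by (cases "x \<in> C") auto
    with L(1) that show thesis by force
  qed
  obtain R where R: "\<And>x. x \<in> C \<Longrightarrow> norm x \<le> R"
    using compact_imp_bounded[OF C(1)] by (auto simp: bounded_iff)
  let ?B = "cball 0 (R + norm b) :: 'a set"
  have bound: "norm (g n x) \<le> L * indicator ?B x" for n x
  proof (cases "x \<in> ?B")
    case True
    have "\<exists>t\<in>{0<..<h n}. norm (F (h n *\<^sub>R b + x) - F (0 *\<^sub>R b + x))
        \<le> norm (F' (t *\<^sub>R b + x) ((h n - 0) *\<^sub>R b))"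
    proof (rule mvt_general)
      have der: "((\<lambda>t. F (t *\<^sub>R b + x)) has_derivative (\<lambda>s. F' (t *\<^sub>R b + x) (s *\<^sub>R b))) (at t)" for t
        by (rule has_derivative_compose[of "\<lambda>t. t *\<^sub>R b + x", OF _ F])
           (auto intro!: derivative_eq_intros)
      then show "((\<lambda>t. F (t *\<^sub>R b + x)) has_derivative (\<lambda>s. F' (t *\<^sub>R b + x) (s *\<^sub>R b))) (at t)" for t .
      show "continuous_on {0..h n} (\<lambda>t. F (t *\<^sub>R b + x))"
        using der by (auto intro!: continuous_at_imp_continuous_on has_derivative_continuous)
    qed (rule h)
    then obtain t where "norm (F (h n *\<^sub>R b + x) - F x) \<le> norm (F' (t *\<^sub>R b + x) (h n *\<^sub>R b))"
      by auto
    also have "F' (t *\<^sub>R b + x) (h n *\<^sub>R b) = h n *\<^sub>R F' (t *\<^sub>R b + x) b"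
      using F by (intro linear_cmul has_derivative_linear)
    also have "norm \<dots> \<le> h n * L"
      using L(1)[of "t *\<^sub>R b + x"] h[of n] by simp
    finally show ?thesis
      using True h[of n] by (simp add: g_def divide_simps mult.commute norm_inverse)
  next
    case False
    have "norm x \<le> norm (h n *\<^sub>R b + x) + norm (h n *\<^sub>R b)"
      using norm_triangle_ineq4[of "h n *\<^sub>R b + x" "h n *\<^sub>R b"] by simp
    moreover have "norm (h n *\<^sub>R b) \<le> norm b"
      using h[of n] by (simp add: mult_left_le_one_le)
    ultimately have "x \<notin> C" "h n *\<^sub>R b + x \<notin> C"
      using False R[of x] R[of "h n *\<^sub>R b + x"] norm_ge_zero[of b] by (auto simp: dist_norm)
    then show ?thesis using C(2) False by (simp add: g_def)
  qed
  have "(\<lambda>n. \<integral>x. g n x \<partial>lborel) \<longlonglongrightarrow> (\<integral>x. F' x b \<partial>lborel)"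
  proof (rule integral_dominated_convergence)
    show "(\<lambda>x. F' x b) \<in> borel_measurable lborel"
      using cont by (simp add: borel_measurable_continuous_onI)
    show "g n \<in> borel_measurable lborel" for n
      unfolding g_def using shift(1) Fint by (intro borel_measurable_integrable) simp
    have "integrable lborel (indicat_real ?B)"
      using emeasure_lborel_cball_finite[of "0::'a" "R + norm b"]
      by (intro integrable_real_indicator) simp_all
    then show "integrable lborel (\<lambda>x. L * indicat_real ?B x)" by simp
    show "AE x in lborel. norm (g n x) \<le> L * indicat_real ?B x" for n
      by (intro AE_I2 bound)
    have "(\<lambda>n. g n x) \<longlonglongrightarrow> F' x b" for x
    proof -
      have "((\<lambda>t. F (t *\<^sub>R b + x)) has_derivative (\<lambda>s. F' (0 *\<^sub>R b + x) (s *\<^sub>R b))) (at 0)"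
        by (rule has_derivative_compose[of "\<lambda>t. t *\<^sub>R b + x", OF _ F])
           (auto intro!: derivative_eq_intros)
      moreover have "F' x (s *\<^sub>R b) = s *\<^sub>R F' x b" for s
        using F by (intro linear_cmul has_derivative_linear)
      ultimately have "((\<lambda>t. F (t *\<^sub>R b + x)) has_derivative (\<lambda>s. s *\<^sub>R F' x b)) (at 0)"
        by simp
      then have "((\<lambda>t. norm (F (t *\<^sub>R b + x) - F x - t *\<^sub>R F' x b) / norm t) \<longlongrightarrow> 0) (at 0)"
        by (simp add: has_derivative_at)
      moreover have "norm (F (t *\<^sub>R b + x) - F x - t *\<^sub>R F' x b) / norm t
          = norm ((F (t *\<^sub>R b + x) - F x) /\<^sub>R t - F' x b)" if "t \<noteq> 0" for t
      proof -
        have "(F (t *\<^sub>R b + x) - F x) /\<^sub>R t - F' x b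
            = (F (t *\<^sub>R b + x) - F x - t *\<^sub>R F' x b) /\<^sub>R t"
          using that by (simp add: scaleR_diff_right)
        then show ?thesis by (simp only: norm_scaleR) (simp add: divide_inverse)
      qed
      then have "eventually (\<lambda>t. norm (F (t *\<^sub>R b + x) - F x - t *\<^sub>R F' x b) / norm t
          = norm ((F (t *\<^sub>R b + x) - F x) /\<^sub>R t - F' x b)) (at 0)"
        by (simp add: eventually_at_filter)
      ultimately have "((\<lambda>t. norm ((F (t *\<^sub>R b + x) - F x) /\<^sub>R t - F' x b)) \<longlongrightarrow> 0) (at 0)"
        by (simp only: tendsto_cong)
      then have "((\<lambda>t. (F (t *\<^sub>R b + x) - F x) /\<^sub>R t) \<longlongrightarrow> F' x b) (at 0)"
        by (rule LIM_zero_cancel[OF tendsto_norm_zero_cancel])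
      moreover have "filterlim h (at 0) sequentially"
      proof -
        have "h \<longlonglongrightarrow> 0"
          unfolding h_def by (rule LIMSEQ_inverse_real_of_nat)
        moreover have "h n \<noteq> 0" for n using h(1)[of n] by simp
        ultimately show ?thesis by (simp add: filterlim_at)
      qed
      ultimately show ?thesis
        unfolding g_def by (rule filterlim_compose)
    qed
    then show "AE x in lborel. (\<lambda>n. g n x) \<longlonglongrightarrow> F' x b" by (intro AE_I2)
  qed
  then show ?thesis by (simp add: g0 LIMSEQ_const_iff)
qed

section \<open>Weak derivatives and scaling in Sobolev spaces\<close>

lemma L2_mult_integrable:
  assumes "u \<in> L2 \<Omega>" "v \<in> L2 \<Omega>"
  shows "integrable (lebesgue_on \<Omega>) (\<lambda>x. u x * v x)"
proof (rule Bochner_Integration.integrable_bound)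
  show "integrable (lebesgue_on \<Omega>) (\<lambda>x. (cmod (u x))\<^sup>2 + (cmod (v x))\<^sup>2)"
    using assms by (auto simp: L2_def)
  show "(\<lambda>x. u x * v x) \<in> borel_measurable (lebesgue_on \<Omega>)"
    using assms by (intro borel_measurable_times) (auto simp: L2_def)
  have "r * s \<le> r\<^sup>2 + s\<^sup>2" if "r \<ge> 0" "s \<ge> 0" for r s :: real
    using sum_squares_bound[of r s] mult_nonneg_nonneg[OF that] by linarith
  then show "AE x in lebesgue_on \<Omega>. norm (u x * v x) \<le> norm ((cmod (u x))\<^sup>2 + (cmod (v x))\<^sup>2)"
    by (intro AE_I2) (simp add: norm_mult)
qed

lemma L2_cmult: "u \<in> L2 \<Omega> \<Longrightarrow> (\<lambda>x. c * u x) \<in> L2 \<Omega>"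
  by (auto simp: L2_def norm_mult power_mult_distrib)

lemma L2_diff:
  assumes "u \<in> L2 \<Omega>" "v \<in> L2 \<Omega>"
  shows "(\<lambda>x. u x - v x) \<in> L2 \<Omega>"
proof -
  have m: "(\<lambda>x. u x - v x) \<in> borel_measurable (lebesgue_on \<Omega>)"
    using assms by (auto simp: L2_def)
  have "integrable (lebesgue_on \<Omega>) (\<lambda>x. (cmod (u x - v x))\<^sup>2)"
  proof (rule Bochner_Integration.integrable_bound)
    show "integrable (lebesgue_on \<Omega>) (\<lambda>x. 2 * (cmod (u x))\<^sup>2 + 2 * (cmod (v x))\<^sup>2)"
      using assms by (auto simp: L2_def)
    show "(\<lambda>x. (cmod (u x - v x))\<^sup>2) \<in> borel_measurable (lebesgue_on \<Omega>)"
      using m by simp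
    have "(cmod (z - w))\<^sup>2 \<le> 2 * (cmod z)\<^sup>2 + 2 * (cmod w)\<^sup>2" for z w
    proof -
      have "(cmod (z - w))\<^sup>2 \<le> (cmod z + cmod w)\<^sup>2"
        by (intro power_mono norm_triangle_ineq4) simp
      also have "\<dots> \<le> 2 * (cmod z)\<^sup>2 + 2 * (cmod w)\<^sup>2"
        using sum_squares_bound[of "cmod z" "cmod w"] by (simp add: power2_sum)
      finally show ?thesis .
    qed
    then show "AE x in lebesgue_on \<Omega>. norm ((cmod (u x - v x))\<^sup>2)
        \<le> norm (2 * (cmod (u x))\<^sup>2 + 2 * (cmod (v x))\<^sup>2)"
      by (intro AE_I2) simp
  qed
  with m show ?thesis by (simp add: L2_def)
qed

lemma compact_support_L2:
  assumes "open \<Omega>" "continuous_on UNIV f" "compact C" "C \<subseteq> \<Omega>" "\<And>x. x \<notin> C \<Longrightarrow> f x = 0"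
  shows "f \<in> L2 \<Omega>"
proof -
  have cont: "continuous_on UNIV (\<lambda>x. (cmod (f x))\<^sup>2)" using assms(2) by (intro continuous_intros)
  have "integrable (lebesgue_on \<Omega>) (\<lambda>x. (cmod (f x))\<^sup>2)"
    using compact_support_integrable[OF cont assms(3)] restrict_integral_to_support(1)[OF assms(1) cont] assms(4,5)
    by force
  moreover have "f \<in> borel_measurable (lebesgue_on \<Omega>)"
    using assms(2)
    by (intro measurable_restrict_space1 measurable_completion) (simp add: borel_measurable_continuous_onI)
  ultimately show ?thesis by (simp add: L2_def)
qed

lemma test_fun_support:
  assumes "\<phi> \<in> test_fun \<Omega>"
  obtains C where "compact C" "C \<subseteq> \<Omega>" "\<And>x. x \<notin> C \<Longrightarrow> \<phi> x = 0"
    "\<And>x b. x \<notin> C \<Longrightarrow> frechet_derivative \<phi> (at x) b = 0"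
proof -
  obtain C where C: "compact C" "C \<subseteq> \<Omega>" "\<And>x. x \<notin> C \<Longrightarrow> \<phi> x = 0"
    using assms by (auto simp: test_fun_def)
  have "frechet_derivative \<phi> (at x) b = 0" if "x \<notin> C" for x b
  proof -
    have "((\<lambda>_. 0) has_derivative (\<lambda>_. 0)) (at x)" by simp
    then have "(\<phi> has_derivative (\<lambda>_. 0)) (at x)"
    proof (rule has_derivative_transform_within_open)
      show "open (- C)" using C(1) by (simp add: compact_imp_closed open_Compl)
    qed (use that C(3) in auto)
    then show ?thesis by (metis frechet_derivative_at)
  qed
  with C that show thesis by blast
qed

lemma test_fun_smooth: "\<phi> \<in> test_fun \<Omega> \<Longrightarrow> smooth \<phi>"
  by (simp add: test_fun_def)

lemma test_fun_L2:
  assumes "open \<Omega>" "\<phi> \<in> test_fun \<Omega>"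
  shows "\<phi> \<in> L2 \<Omega>" "(\<lambda>x. frechet_derivative \<phi> (at x) b) \<in> L2 \<Omega>"
proof -
  obtain C where C: "compact C" "C \<subseteq> \<Omega>" "\<And>x. x \<notin> C \<Longrightarrow> \<phi> x = 0"
    "\<And>x b. x \<notin> C \<Longrightarrow> frechet_derivative \<phi> (at x) b = 0"
    using test_fun_support[OF assms(2)] by blast
  show "\<phi> \<in> L2 \<Omega>" "(\<lambda>x. frechet_derivative \<phi> (at x) b) \<in> L2 \<Omega>"
    using C smooth_continuous smooth_continuous_pderiv test_fun_smooth[OF assms(2)]
    by (auto intro!: compact_support_L2[OF assms(1) _ C(1,2)])
qed

lemma test_fun_cmult: "\<phi> \<in> test_fun \<Omega> \<Longrightarrow> (\<lambda>x. c * \<phi> x) \<in> test_fun \<Omega>"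
  unfolding test_fun_def smooth_def by (auto intro: C_k_cmult)

text \<open>
Integration by parts: the derivative of the product \<open>\<phi> \<psi>\<close>, which has compact support in \<open>\<Omega>\<close>,
integrates to zero.
\<close>

lemma has_weak_pderiv_test_fun:
  assumes "open \<Omega>" "\<phi> \<in> test_fun \<Omega>"
  shows "has_weak_pderiv \<Omega> b \<phi> (\<lambda>x. frechet_derivative \<phi> (at x) b)"
  unfolding has_weak_pderiv_def
proof (intro conjI ballI)
  let ?D = "\<lambda>\<psi> x. frechet_derivative \<psi> (at x)"
  show "(\<lambda>x. ?D \<phi> x b) \<in> L2 \<Omega>" by (rule test_fun_L2[OF assms])
  fix \<psi> assume \<psi>: "\<psi> \<in> test_fun \<Omega>"
  obtain C where C: "compact C" "C \<subseteq> \<Omega>" "\<And>x. x \<notin> C \<Longrightarrow> \<phi> x = 0"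
    "\<And>x b. x \<notin> C \<Longrightarrow> ?D \<phi> x b = 0"
    using test_fun_support[OF assms(2)] by blast
  let ?F' = "\<lambda>x v. \<phi> x * ?D \<psi> x v + ?D \<phi> x v * \<psi> x"
  have sm: "smooth \<phi>" "smooth \<psi>" using assms(2) \<psi> by (simp_all add: test_fun_smooth)
  have cont: "continuous_on UNIV (\<lambda>x. ?F' x b)"
    by (intro continuous_intros smooth_continuous smooth_continuous_pderiv sm)
  have "(\<integral>x. ?F' x b \<partial>lebesgue_on \<Omega>) = (\<integral>x. ?F' x b \<partial>lborel)"
  proof (rule restrict_integral_to_support(2)[OF assms(1) cont])
    fix x assume "x \<notin> \<Omega>"
    then have "x \<notin> C" using C(2) by blast
    then show "?F' x b = 0" using C(3,4) by simp
  qed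
  also have "\<dots> = 0"
  proof (rule integral_directional_derivative_eq_0[where F = "\<lambda>x. \<phi> x * \<psi> x" and F' = ?F' and b = b and C = C])
    show "((\<lambda>x. \<phi> x * \<psi> x) has_derivative ?F' x) (at x)" for x
      by (intro has_derivative_mult smooth_differentiable sm)
  qed (use C cont in auto)
  finally show "(\<integral>x. \<phi> x * ?D \<psi> x b \<partial>lebesgue_on \<Omega>) = - (\<integral>x. ?D \<phi> x b * \<psi> x \<partial>lebesgue_on \<Omega>)"
    by (simp add: eq_neg_iff_add_eq_0 L2_mult_integrable test_fun_L2[OF assms] test_fun_L2[OF assms(1) \<psi>])
qed

lemma has_weak_pderiv_unique:
  assumes "open \<Omega>" "has_weak_pderiv \<Omega> b u w" "has_weak_pderiv \<Omega> b u w'"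
  shows "AE x in lebesgue_on \<Omega>. w x = w' x"
proof -
  have L2: "w \<in> L2 \<Omega>" "w' \<in> L2 \<Omega>" using assms by (simp_all add: has_weak_pderiv_def)
  have "AE x in lebesgue_on \<Omega>. w x - w' x = 0"
  proof (rule fundamental_lemma_L2[OF assms(1) L2_diff[OF L2]])
    fix \<phi> assume \<phi>: "\<phi> \<in> test_fun \<Omega>"
    have "(\<integral>x. w x * \<phi> x \<partial>lebesgue_on \<Omega>) = (\<integral>x. w' x * \<phi> x \<partial>lebesgue_on \<Omega>)"
      using assms(2,3) \<phi> unfolding has_weak_pderiv_def by (metis neg_equal_iff_equal)
    then show "(\<integral>x. (w x - w' x) * \<phi> x \<partial>lebesgue_on \<Omega>) = 0"
      by (simp add: left_diff_distrib L2_mult_integrable L2 test_fun_L2(1)[OF assms(1) \<phi>])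
  qed
  then show ?thesis by simp
qed

lemma has_weak_pderiv_weak_pderiv:
  "has_weak_pderiv \<Omega> b u w \<Longrightarrow> has_weak_pderiv \<Omega> b u (weak_pderiv \<Omega> b u)"
  unfolding weak_pderiv_def by (rule someI[of "has_weak_pderiv \<Omega> b u"])

lemma H1_weak_pderiv:
  "u \<in> H1 \<Omega> \<Longrightarrow> b \<in> Basis \<Longrightarrow> has_weak_pderiv \<Omega> b u (weak_pderiv \<Omega> b u)"
  unfolding H1_def by (auto intro: has_weak_pderiv_weak_pderiv)

lemma has_weak_pderiv_cmult:
  "has_weak_pderiv \<Omega> b u w \<Longrightarrow> has_weak_pderiv \<Omega> b (\<lambda>x. c * u x) (\<lambda>x. c * w x)"
  unfolding has_weak_pderiv_def by (auto intro: L2_cmult simp: mult.assoc)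

lemma has_weak_pderiv_diff:
  assumes "open \<Omega>" "u \<in> L2 \<Omega>" "v \<in> L2 \<Omega>"
    and u: "has_weak_pderiv \<Omega> b u w" and v: "has_weak_pderiv \<Omega> b v w'"
  shows "has_weak_pderiv \<Omega> b (\<lambda>x. u x - v x) (\<lambda>x. w x - w' x)"
  unfolding has_weak_pderiv_def
proof (intro conjI ballI)
  show "(\<lambda>x. w x - w' x) \<in> L2 \<Omega>" using u v by (intro L2_diff) (auto simp: has_weak_pderiv_def)
  fix \<phi> assume \<phi>: "\<phi> \<in> test_fun \<Omega>"
  let ?M = "lebesgue_on \<Omega>" and ?D = "\<lambda>x. frechet_derivative \<phi> (at x) b"
  have "w \<in> L2 \<Omega>" "w' \<in> L2 \<Omega>" using u v by (simp_all add: has_weak_pderiv_def)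
  then have int: "integrable ?M (\<lambda>x. w x * \<phi> x)" "integrable ?M (\<lambda>x. w' x * \<phi> x)"
    "integrable ?M (\<lambda>x. u x * ?D x)" "integrable ?M (\<lambda>x. v x * ?D x)"
    using assms(2,3) test_fun_L2[OF assms(1) \<phi>] by (simp_all add: L2_mult_integrable)
  then show "(\<integral>x. (u x - v x) * frechet_derivative \<phi> (at x) b \<partial>lebesgue_on \<Omega>)
      = - (\<integral>x. (w x - w' x) * \<phi> x \<partial>lebesgue_on \<Omega>)"
    using u v \<phi> by (simp add: left_diff_distrib has_weak_pderiv_def)
qed

lemma H1_diff:
  assumes "open \<Omega>" "u \<in> H1 \<Omega>" "v \<in> H1 \<Omega>"
  shows "(\<lambda>x. u x - v x) \<in> H1 \<Omega>"
proof -
  have "u \<in> L2 \<Omega>" "v \<in> L2 \<Omega>" using assms by (simp_all add: H1_def)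
  with assms(2,3) show ?thesis
    unfolding H1_def using has_weak_pderiv_diff[OF assms(1)] L2_diff by blast
qed

lemma H1_cmult: "u \<in> H1 \<Omega> \<Longrightarrow> (\<lambda>x. c * u x) \<in> H1 \<Omega>"
  unfolding H1_def using L2_cmult has_weak_pderiv_cmult by blast

lemma test_fun_H1: "open \<Omega> \<Longrightarrow> \<phi> \<in> test_fun \<Omega> \<Longrightarrow> \<phi> \<in> H1 \<Omega>"
  unfolding H1_def using test_fun_L2(1) has_weak_pderiv_test_fun by blast

lemma grad_sq_nonneg: "0 \<le> grad_sq \<Omega> u x"
  by (simp add: grad_sq_def sum_nonneg)

lemma grad_sq_integrable: "u \<in> H1 \<Omega> \<Longrightarrow> integrable (lebesgue_on \<Omega>) (grad_sq \<Omega> u)"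
  unfolding grad_sq_def[abs_def]
  by (intro Bochner_Integration.integrable_sum) (auto dest: H1_weak_pderiv simp: has_weak_pderiv_def L2_def)

text \<open>
Holds only almost everywhere: \<open>weak_pderiv\<close> chooses its representatives for \<open>u\<close> and for \<open>c u\<close>
independently of each other. For \<open>c = 0\<close> it says that the zero function has zero gradient.
\<close>

lemma grad_sq_cmult:
  assumes "open \<Omega>" "u \<in> H1 \<Omega>"
  shows "AE x in lebesgue_on \<Omega>. grad_sq \<Omega> (\<lambda>x. c * u x) x = (cmod c)\<^sup>2 * grad_sq \<Omega> u x"
proof -
  have "AE x in lebesgue_on \<Omega>. \<forall>b\<in>Basis. weak_pderiv \<Omega> b (\<lambda>x. c * u x) x = c * weak_pderiv \<Omega> b u x"
  proof (rule AE_finite_allI)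
    fix b :: 'a assume "b \<in> Basis"
    then have "has_weak_pderiv \<Omega> b (\<lambda>x. c * u x) (\<lambda>x. c * weak_pderiv \<Omega> b u x)"
      by (intro has_weak_pderiv_cmult H1_weak_pderiv assms(2))
    then show "AE x in lebesgue_on \<Omega>. weak_pderiv \<Omega> b (\<lambda>x. c * u x) x = c * weak_pderiv \<Omega> b u x"
      using has_weak_pderiv_unique[OF assms(1) has_weak_pderiv_weak_pderiv] by blast
  qed simp
  then show ?thesis
  proof eventually_elim
    case (elim x)
    then show ?case
      by (simp add: grad_sq_def norm_mult power_mult_distrib sum_distrib_left)
  qed
qed

definition energy :: "'a::euclidean_space set \<Rightarrow> real \<Rightarrow> ('a \<Rightarrow> complex) \<Rightarrow> real" where
  "energy \<Omega> \<omega> u = (\<integral>x. grad_sq \<Omega> u x + \<omega> * (cmod (u x))\<^sup>2 \<partial>lebesgue_on \<Omega>)"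

lemma energy_integrable:
  "u \<in> H1 \<Omega> \<Longrightarrow> integrable (lebesgue_on \<Omega>) (\<lambda>x. grad_sq \<Omega> u x + \<omega> * (cmod (u x))\<^sup>2)"
  by (intro Bochner_Integration.integrable_add grad_sq_integrable) (auto simp: H1_def L2_def)

lemma energy_cmult:
  assumes "open \<Omega>" "u \<in> H1 \<Omega>"
  shows "energy \<Omega> \<omega> (\<lambda>x. c * u x) = (cmod c)\<^sup>2 * energy \<Omega> \<omega> u"
proof -
  have "(\<integral>x. grad_sq \<Omega> (\<lambda>x. c * u x) x + \<omega> * (cmod (c * u x))\<^sup>2 \<partial>lebesgue_on \<Omega>)
    = (\<integral>x. (cmod c)\<^sup>2 * (grad_sq \<Omega> u x + \<omega> * (cmod (u x))\<^sup>2) \<partial>lebesgue_on \<Omega>)"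
  proof (rule integral_cong_AE)
    show "(\<lambda>x. grad_sq \<Omega> (\<lambda>x. c * u x) x + \<omega> * (cmod (c * u x))\<^sup>2) \<in> borel_measurable (lebesgue_on \<Omega>)"
      by (intro borel_measurable_integrable energy_integrable H1_cmult assms)
    show "(\<lambda>x. (cmod c)\<^sup>2 * (grad_sq \<Omega> u x + \<omega> * (cmod (u x))\<^sup>2)) \<in> borel_measurable (lebesgue_on \<Omega>)"
      by (intro borel_measurable_integrable integrable_mult_right energy_integrable assms)
    show "AE x in lebesgue_on \<Omega>. grad_sq \<Omega> (\<lambda>x. c * u x) x + \<omega> * (cmod (c * u x))\<^sup>2
        = (cmod c)\<^sup>2 * (grad_sq \<Omega> u x + \<omega> * (cmod (u x))\<^sup>2)"
      using grad_sq_cmult[OF assms, of c]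
      by eventually_elim (simp add: norm_mult power_mult_distrib algebra_simps)
  qed
  then show ?thesis by (simp add: energy_def)
qed

lemma H1_norm_cmult:
  assumes "open \<Omega>" "u \<in> H1 \<Omega>"
  shows "H1_norm \<Omega> (\<lambda>x. c * u x) = cmod c * H1_norm \<Omega> u"
  using energy_cmult[OF assms, of 1 c]
  by (simp add: H1_norm_def energy_def real_sqrt_mult)

text \<open>
The approximating test functions are scaled along with \<open>u\<close>. That their differences with \<open>u\<close> are
in \<open>H1\<close>, where the norm is homogeneous, uses that test functions have weak derivatives.
\<close>

lemma H10_cmult:
  assumes "open \<Omega>" "u \<in> H10 \<Omega>"
  shows "(\<lambda>x. c * u x) \<in> H10 \<Omega>"
proof -
  obtain \<phi> where u: "u \<in> H1 \<Omega>" and \<phi>: "\<And>n. \<phi> n \<in> test_fun \<Omega>"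
    and lim: "(\<lambda>n. H1_norm \<Omega> (\<lambda>x. \<phi> n x - u x)) \<longlonglongrightarrow> 0"
    using assms(2) by (auto simp: H10_def)
  have "(\<lambda>x. \<phi> n x - u x) \<in> H1 \<Omega>" for n
    by (intro H1_diff assms(1) u test_fun_H1 \<phi>)
  then have "H1_norm \<Omega> (\<lambda>x. c * \<phi> n x - c * u x) = cmod c * H1_norm \<Omega> (\<lambda>x. \<phi> n x - u x)" for n
    using H1_norm_cmult[OF assms(1), of "\<lambda>x. \<phi> n x - u x" c] by (simp add: right_diff_distrib)
  then have "(\<lambda>n. H1_norm \<Omega> (\<lambda>x. c * \<phi> n x - c * u x)) \<longlonglongrightarrow> 0"
    using tendsto_mult_right_zero[OF lim, of "cmod c"] by simp
  then show ?thesis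
    unfolding H10_def using H1_cmult[OF u, of c] test_fun_cmult[OF \<phi>, of c]
    by (auto intro!: exI[of _ "\<lambda>n x. c * \<phi> n x"])
qed

section \<open>An inequality for powers of sums\<close>

text \<open>
Each factor \<open>x\<^sub>i\<^bsup>p-1\<^esup>\<close> of \<open>x\<^sub>i\<^bsup>p\<^esup> = x\<^sub>i x\<^sub>i\<^bsup>p-1\<^esup>\<close> is at most the same power of the whole sum.
\<close>

lemma sum_powr_le_powr_sum:
  fixes x :: "'i \<Rightarrow> real"
  assumes "finite K" "\<And>i. i \<in> K \<Longrightarrow> 0 \<le> x i" "1 \<le> p"
  shows "(\<Sum>i\<in>K. x i powr p) \<le> (\<Sum>i\<in>K. x i) powr p"
proof -
  let ?S = "\<Sum>i\<in>K. x i"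
  have split: "y powr p = y * y powr (p - 1)" if "y \<ge> 0" for y :: real
    using powr_mult_base[OF that, of "p - 1"] by simp
  have "(\<Sum>i\<in>K. x i powr p) = (\<Sum>i\<in>K. x i * x i powr (p - 1))"
    using assms(2) split by (intro sum.cong) auto
  also have "\<dots> \<le> (\<Sum>i\<in>K. x i * ?S powr (p - 1))"
    using assms by (intro sum_mono mult_left_mono powr_mono2 member_le_sum) auto
  also have "\<dots> = ?S powr p"
    using split[of ?S] assms(2) by (simp add: sum_distrib_right sum_nonneg)
  finally show ?thesis .
qed

text \<open>
The arithmetic-geometric mean inequality for \<open>a b\<^bsup>p\<^esup>\<close> and \<open>b a\<^bsup>p\<^esup>\<close>, whose product is \<open>(a b)\<^bsup>p+1\<^esup>\<close>.
\<close>

lemma mixed_powr_le: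
  fixes a b p :: real
  assumes "0 \<le> a" "0 \<le> b"
  shows "2 * (a * b) powr ((p + 1) / 2) \<le> a * b powr p + b * a powr p"
proof -
  have "2 * sqrt (a * b powr p) * sqrt (b * a powr p) \<le> a * b powr p + b * a powr p"
    using sum_squares_bound[of "sqrt (a * b powr p)" "sqrt (b * a powr p)"] assms by simp
  moreover have "sqrt (a * b powr p) * sqrt (b * a powr p) = (a * b) powr ((p + 1) / 2)"
  proof (cases "a = 0 \<or> b = 0")
    case False
    then have pos: "a > 0" "b > 0" using assms by auto
    have "sqrt (a * b powr p) * sqrt (b * a powr p) = sqrt ((a * b) * (a * b) powr p)"
      using assms by (simp add: powr_mult real_sqrt_mult[symmetric] mult_ac)
    also have "(a * b) * (a * b) powr p = (a * b) powr (p + 1)"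
      using pos by (simp add: powr_add mult.commute)
    also have "sqrt \<dots> = (a * b) powr ((p + 1) / 2)"
      by (simp add: powr_half_sqrt[symmetric] powr_powr)
    finally show ?thesis .
  qed auto
  ultimately show ?thesis by simp
qed

text \<open>
This is where a coupling weaker than the self-interaction loses. Expanding \<open>(\<Sum> x\<^sub>i) (\<Sum> x\<^sub>j\<^bsup>p\<^esup>)\<close>, which
is at most \<open>(\<Sum> x\<^sub>i)\<^bsup>p+1\<^esup>\<close>, and symmetrising, the diagonal terms are the \<open>x\<^sub>i\<^bsup>p+1\<^esup>\<close> and each
off-diagonal term dominates \<open>(x\<^sub>i x\<^sub>j)\<^bsup>(p+1)/2\<^esup>\<close>. The inequality is strict because \<open>\<theta> < 1\<close> and
some off-diagonal term is positive.
\<close>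

lemma coupled_sum_less_powr_sum:
  fixes x :: "'i \<Rightarrow> real"
  assumes "finite K" and x: "\<And>i. i \<in> K \<Longrightarrow> 0 \<le> x i" and "1 \<le> p" "\<theta> < 1"
    and ab: "a \<in> K" "b \<in> K" "a \<noteq> b" "0 < x a" "0 < x b"
  shows "(\<Sum>i\<in>K. \<Sum>j\<in>K. (if i = j then 1 else \<theta>) * (x i * x j) powr ((p + 1) / 2))
    < (\<Sum>i\<in>K. x i) powr (p + 1)"
proof -
  let ?q = "\<lambda>i j. (x i * x j) powr ((p + 1) / 2)"
  let ?l = "\<lambda>i j. (if i = j then 1 else \<theta>) * ?q i j"
  let ?s = "\<lambda>i j. (x i * x j powr p + x j * x i powr p) / 2"
  have q: "?q i j \<le> ?s i j" if "i \<in> K" "j \<in> K" for i j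
    using mixed_powr_le[of "x i" "x j" p] x that by simp
  have "?l i j \<le> 1 * ?q i j" for i j
    using assms(4) by (intro mult_right_mono) auto
  then have lq: "?l i j \<le> ?q i j" for i j by (simp only: mult_1)
  have le: "?l i j \<le> ?s i j" if "i \<in> K" "j \<in> K" for i j
    using lq q[OF that] by (rule order_trans)
  have "?l a b < 1 * ?q a b"
    using ab assms(4) by (intro mult_strict_right_mono) auto
  then have "?l a b < ?q a b" by (simp only: mult_1)
  then have less: "?l a b < ?s a b" using q[OF ab(1,2)] by (rule less_le_trans)
  have "(\<Sum>i\<in>K. \<Sum>j\<in>K. ?l i j) < (\<Sum>i\<in>K. \<Sum>j\<in>K. ?s i j)"
  proof (rule sum_strict_mono_ex1[OF assms(1)])
    show "\<forall>i\<in>K. (\<Sum>j\<in>K. ?l i j) \<le> (\<Sum>j\<in>K. ?s i j)"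
      by (intro ballI sum_mono le)
    have "(\<Sum>j\<in>K. ?l a j) < (\<Sum>j\<in>K. ?s a j)"
      using le less ab by (intro sum_strict_mono_ex1[OF assms(1)]) blast+
    then show "\<exists>i\<in>K. (\<Sum>j\<in>K. ?l i j) < (\<Sum>j\<in>K. ?s i j)"
      using ab(1) by blast
  qed
  also have "(\<Sum>i\<in>K. \<Sum>j\<in>K. ?s i j) = (\<Sum>i\<in>K. \<Sum>j\<in>K. x i * x j powr p)"
  proof -
    have "(\<Sum>i\<in>K. \<Sum>j\<in>K. x j * x i powr p) = (\<Sum>i\<in>K. \<Sum>j\<in>K. x i * x j powr p)"
      by (rule sum.swap)
    then show ?thesis by (simp add: sum_divide_distrib[symmetric] sum.distrib)
  qed
  also have "\<dots> = (\<Sum>i\<in>K. x i) * (\<Sum>j\<in>K. x j powr p)"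
    by (simp add: sum_product)
  also have "\<dots> \<le> (\<Sum>i\<in>K. x i) * (\<Sum>j\<in>K. x j) powr p"
    using assms by (intro mult_left_mono sum_powr_le_powr_sum sum_nonneg) auto
  also have "\<dots> = (\<Sum>i\<in>K. x i) powr (p + 1)"
    using powr_mult_base[of "\<Sum>i\<in>K. x i" p] x by (simp add: sum_nonneg add.commute)
  finally show ?thesis .
qed

section \<open>The interaction functional\<close>

definition overlap :: "'a::euclidean_space set \<Rightarrow> real \<Rightarrow> ('a \<Rightarrow> complex) \<Rightarrow> ('a \<Rightarrow> complex) \<Rightarrow> ennreal" where
  "overlap \<Omega> p u v = (\<integral>\<^sup>+x. ennreal (cmod (u x) powr (p + 1) * cmod (v x) powr (p + 1)) \<partial>lebesgue_on \<Omega>)"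

lemma overlap_Cauchy_Schwarz:
  assumes "u \<in> borel_measurable (lebesgue_on \<Omega>)" "v \<in> borel_measurable (lebesgue_on \<Omega>)"
  shows "(overlap \<Omega> p u v)\<^sup>2 \<le> overlap \<Omega> p u u * overlap \<Omega> p v v"
proof -
  note [measurable] = assms
  show ?thesis
    using Cauchy_Schwarz_nn_integral[of "\<lambda>x. ennreal (cmod (u x) powr (p + 1))" "lebesgue_on \<Omega>"
        "\<lambda>x. ennreal (cmod (v x) powr (p + 1))"]
    by (simp add: overlap_def ennreal_mult'' power2_eq_square)
qed

lemma overlap_self_eq_0_iff:
  assumes "u \<in> borel_measurable (lebesgue_on \<Omega>)"
  shows "overlap \<Omega> p u u = 0 \<longleftrightarrow> zero_on \<Omega> u"
proof -
  note [measurable] = assms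
  have "overlap \<Omega> p u u = 0 \<longleftrightarrow>
      (AE x in lebesgue_on \<Omega>. ennreal (cmod (u x) powr (p + 1) * cmod (u x) powr (p + 1)) = 0)"
    unfolding overlap_def by (rule nn_integral_0_iff_AE) measurable
  then show ?thesis by (simp add: zero_on_def ennreal_eq_0_iff mult_le_0_iff)
qed

lemma overlap_self_cmult:
  assumes "u \<in> borel_measurable (lebesgue_on \<Omega>)" "0 \<le> c"
  shows "overlap \<Omega> p (\<lambda>x. complex_of_real c * u x) (\<lambda>x. complex_of_real c * u x)
    = ennreal (c powr (2 * p + 2)) * overlap \<Omega> p u u"
proof -
  note [measurable] = assms(1)
  have "(c * r) powr (p + 1) * (c * r) powr (p + 1)
      = c powr (2 * p + 2) * (r powr (p + 1) * r powr (p + 1))" if "r \<ge> 0" for r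
  proof -
    have "c powr (2 * p + 2) = c powr (p + 1) * c powr (p + 1)"
      by (simp add: powr_add[symmetric])
    then show ?thesis using that assms(2) by (simp add: powr_mult mult_ac)
  qed
  then have "overlap \<Omega> p (\<lambda>x. complex_of_real c * u x) (\<lambda>x. complex_of_real c * u x)
      = (\<integral>\<^sup>+x. ennreal (c powr (2 * p + 2))
          * ennreal (cmod (u x) powr (p + 1) * cmod (u x) powr (p + 1)) \<partial>lebesgue_on \<Omega>)"
    using assms(2) by (simp add: overlap_def norm_mult ennreal_mult[symmetric])
  also have "\<dots> = ennreal (c powr (2 * p + 2)) * overlap \<Omega> p u u"
    unfolding overlap_def by (rule nn_integral_cmult) measurable
  finally show ?thesis .
qed

lemma J_fun_eq_overlap:
  "J_fun \<Omega> p k K U = (\<Sum>i\<in>K. \<Sum>j\<in>K. ereal (k i j) * enn2ereal (overlap \<Omega> p (U i) (U j)))"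
  unfolding J_fun_def overlap_def ..

text \<open>
The coefficients are positive, so a single infinite overlap would make \<open>J\<close> infinite. Hence being at a
finite level already puts the components into \<open>L\<^bsup>2p+2\<^esup>\<close>.
\<close>

lemma overlap_finite:
  assumes "finite K" "\<And>i j. i \<in> K \<Longrightarrow> j \<in> K \<Longrightarrow> 0 < k i j"
    and "J_fun \<Omega> p k K U = ereal l" "i \<in> K" "j \<in> K"
  shows "overlap \<Omega> p (U i) (U j) < \<infinity>"
proof (rule ccontr)
  assume "\<not> overlap \<Omega> p (U i) (U j) < \<infinity>"
  then have "overlap \<Omega> p (U i) (U j) = \<infinity>" by (simp add: less_top[symmetric])
  moreover have "0 < k i j" by (rule assms(2)[OF assms(4,5)])
  ultimately have "ereal (k i j) * enn2ereal (overlap \<Omega> p (U i) (U j)) = \<infinity>" by simp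
  then have "(\<Sum>j\<in>K. ereal (k i j) * enn2ereal (overlap \<Omega> p (U i) (U j))) = \<infinity>"
    unfolding sum_Pinfty using assms(1,5) by blast
  then have "J_fun \<Omega> p k K U = \<infinity>"
    unfolding J_fun_eq_overlap sum_Pinfty using assms(1,4) by blast
  then show False using assms(3) by simp
qed

lemma J_fun_eq_sum_real:
  assumes "\<And>i j. i \<in> K \<Longrightarrow> j \<in> K \<Longrightarrow> overlap \<Omega> p (U i) (U j) < \<infinity>"
  shows "J_fun \<Omega> p k K U = ereal (\<Sum>i\<in>K. \<Sum>j\<in>K. k i j * enn2real (overlap \<Omega> p (U i) (U j)))"
proof -
  have "enn2ereal (overlap \<Omega> p (U i) (U j)) = ereal (enn2real (overlap \<Omega> p (U i) (U j)))"
    if "i \<in> K" "j \<in> K" for i j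
    using assms[OF that] by (cases "overlap \<Omega> p (U i) (U j)") (auto simp: enn2ereal_ennreal)
  then show ?thesis by (simp add: J_fun_eq_overlap)
qed

section \<open>Minimisers have one component\<close>

lemma I_fun_eq_energy: "I_fun \<Omega> \<omega> K U = (\<Sum>i\<in>K. energy \<Omega> (\<omega> i) (U i))"
  unfolding I_fun_def energy_def ..

lemma energy_nonneg: "0 \<le> \<omega> \<Longrightarrow> 0 \<le> energy \<Omega> \<omega> u"
  unfolding energy_def by (intro integral_nonneg_AE AE_I2) (simp add: grad_sq_nonneg)

lemma energy_pos:
  assumes "u \<in> H1 \<Omega>" "0 < \<omega>" "\<not> zero_on \<Omega> u"
  shows "0 < energy \<Omega> \<omega> u"
proof -
  have nonneg: "0 \<le> grad_sq \<Omega> u x + \<omega> * (cmod (u x))\<^sup>2" for x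
    using assms(2) by (simp add: grad_sq_nonneg)
  have "energy \<Omega> \<omega> u \<noteq> 0"
  proof
    assume "energy \<Omega> \<omega> u = 0"
    then have "AE x in lebesgue_on \<Omega>. grad_sq \<Omega> u x + \<omega> * (cmod (u x))\<^sup>2 = 0"
      unfolding energy_def
      using integral_nonneg_eq_0_iff_AE[OF energy_integrable[OF assms(1)]] nonneg by blast
    then have "AE x in lebesgue_on \<Omega>. u x = 0"
    proof eventually_elim
      case (elim x)
      moreover have "0 \<le> grad_sq \<Omega> u x" "0 \<le> \<omega> * (cmod (u x))\<^sup>2"
        using assms(2) by (simp_all add: grad_sq_nonneg)
      ultimately have "\<omega> * (cmod (u x))\<^sup>2 = 0" by linarith
      then show ?case using assms(2) by simp
    qed
    then show False using assms(3) by (simp add: zero_on_def)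
  qed
  then show ?thesis using energy_nonneg[of \<omega> \<Omega> u] assms(2) by simp
qed

lemma J_fun_single:
  assumes "finite K" "m \<in> K" "\<And>i. i \<in> K \<Longrightarrow> i \<noteq> m \<Longrightarrow> \<forall>x. W i x = 0"
  shows "J_fun \<Omega> p k K W = ereal (k m m) * enn2ereal (overlap \<Omega> p (W m) (W m))"
proof -
  have 0: "overlap \<Omega> p (W i) (W j) = 0" if "i \<in> K" "j \<in> K" "i \<noteq> m \<or> j \<noteq> m" for i j
    using assms(3) that by (auto simp: overlap_def)
  have "J_fun \<Omega> p k K W = (\<Sum>i\<in>K. if i = m then
      (\<Sum>j\<in>K. if j = m then ereal (k m m) * enn2ereal (overlap \<Omega> p (W m) (W m)) else 0) else 0)"
    unfolding J_fun_eq_overlap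
  proof (intro sum.cong refl)
    fix i assume i: "i \<in> K"
    show "(\<Sum>j\<in>K. ereal (k i j) * enn2ereal (overlap \<Omega> p (W i) (W j))) = (if i = m then
      (\<Sum>j\<in>K. if j = m then ereal (k m m) * enn2ereal (overlap \<Omega> p (W m) (W m)) else 0) else 0)"
    proof (cases "i = m")
      case True
      have "(\<Sum>j\<in>K. ereal (k m j) * enn2ereal (overlap \<Omega> p (W m) (W j))) =
        (\<Sum>j\<in>K. if j = m then ereal (k m m) * enn2ereal (overlap \<Omega> p (W m) (W m)) else 0)"
        using 0 assms(2) by (intro sum.cong) (auto simp: zero_ennreal.rep_eq)
      then show ?thesis using True by simp
    next
      case False
      then show ?thesis using 0 i by (simp add: zero_ennreal.rep_eq)
    qed
  qed
  also have "\<dots> = ereal (k m m) * enn2ereal (overlap \<Omega> p (W m) (W m))"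
    using assms(1,2) by simp
  finally show ?thesis .
qed

text \<open>
With \<open>x\<^sub>i = \<parallel>u\<^sub>i\<parallel>\<^sup>2\<close> in \<open>L\<^bsup>2p+2\<^esup>\<close> and \<open>e\<^sub>i\<close> the energy of \<open>u\<^sub>i\<close>, let \<open>m\<close> be the nonzero component of
smallest quotient \<open>r = e\<^sub>m / x\<^sub>m\<close>. Then \<open>I U \<ge> r \<Sum> x\<^sub>i\<close>, whereas concentrating everything in the
component \<open>m\<close>, by a multiple of \<open>u\<^sub>m\<close> at the level \<open>l\<close> of \<open>U\<close>, costs \<open>r (l / \<mu>)\<^bsup>1/(p+1)\<^esup>\<close>. With
two nonzero components the latter is strictly smaller.
\<close>

lemma minimizer_at_most_one_component:
  fixes \<Omega> :: "'a::euclidean_space set"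
  assumes "open \<Omega>" "finite K" "1 \<le> p" and \<omega>: "\<And>i. i \<in> K \<Longrightarrow> 0 < \<omega> i"
    and \<beta>: "0 < \<beta>" "\<beta> < \<mu>"
    and U: "U \<in> minimizers \<Omega> p \<omega> (coupling \<mu> \<beta>) K"
    and a: "a \<in> K" "\<not> zero_on \<Omega> (U a)" and b: "b \<in> K" "\<not> zero_on \<Omega> (U b)"
  shows "a = b"
proof (rule ccontr)
  assume ab: "a \<noteq> b"
  let ?k = "coupling \<mu> \<beta>"
  define l where "l = lambda_G \<Omega> p \<omega> ?k K"
  define t where "t i j = enn2real (overlap \<Omega> p (U i) (U j))" for i j
  define x where "x i = t i i powr (1 / (p + 1))" for i
  define e where "e i = energy \<Omega> (\<omega> i) (U i)" for i
  have H10: "U i \<in> H10 \<Omega>" if "i \<in> K" for i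
    using U that by (simp add: minimizers_def H10_vec_def)
  then have H1: "U i \<in> H1 \<Omega>" if "i \<in> K" for i using that by (simp add: H10_def)
  then have meas: "U i \<in> borel_measurable (lebesgue_on \<Omega>)" if "i \<in> K" for i
    using that by (simp add: H1_def L2_def)
  have JU: "J_fun \<Omega> p ?k K U = ereal l"
    using U by (simp add: minimizers_def l_def)
  have \<mu>: "0 < \<mu>" using \<beta> by simp
  then have kpos: "0 < ?k i j" for i j using \<beta> by (simp add: coupling_def)
  have fin: "overlap \<Omega> p (U i) (U j) < \<infinity>" if "i \<in> K" "j \<in> K" for i j
    by (rule overlap_finite[OF assms(2) kpos JU that])
  have ov: "overlap \<Omega> p (U i) (U j) = ennreal (t i j)" if "i \<in> K" "j \<in> K" for i j
    using fin[OF that] by (simp add: t_def)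
  have t0: "0 \<le> t i j" for i j by (simp add: t_def)
  have tpos: "0 < t i i \<longleftrightarrow> \<not> zero_on \<Omega> (U i)" if "i \<in> K" for i
    using overlap_self_eq_0_iff[OF meas[OF that], of p] ov[OF that that] t0[of i i]
    by (auto simp: less_le)
  have x0: "0 \<le> x i" for i by (simp add: x_def)
  have xpos: "0 < x i" if "i \<in> K" "\<not> zero_on \<Omega> (U i)" for i
    using tpos[OF that(1)] that(2) by (simp add: x_def)
  have tx: "t i i = x i powr (p + 1)" for i
    using t0[of i i] assms(3) by (simp add: x_def powr_powr)
  have CS: "t i j \<le> (x i * x j) powr ((p + 1) / 2)" if "i \<in> K" "j \<in> K" for i j
  proof -
    have "ennreal ((t i j)\<^sup>2) \<le> ennreal (t i i * t j j)"
      using overlap_Cauchy_Schwarz[OF meas[OF that(1)] meas[OF that(2)], of p] that t0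
      by (simp add: ov ennreal_power ennreal_mult)
    then have "(t i j)\<^sup>2 \<le> t i i * t j j"
      using t0 by (simp add: ennreal_le_iff)
    also have "\<dots> = ((x i * x j) powr ((p + 1) / 2))\<^sup>2"
      using x0[of i] x0[of j] assms(3)
      by (simp add: tx powr_mult power2_eq_square powr_add[symmetric] mult_ac
          flip: mult.assoc)
    finally show ?thesis by (rule power2_le_imp_le) simp
  qed
  have l: "l = (\<Sum>i\<in>K. \<Sum>j\<in>K. ?k i j * t i j)"
    using J_fun_eq_sum_real[of K \<Omega> p U ?k] fin JU by (simp add: t_def)
  have "\<mu> * t a a \<le> l"
  proof -
    have "?k a a * t a a \<le> (\<Sum>j\<in>K. ?k a j * t a j)"
      using kpos t0 a(1) assms(2)
      by (intro member_le_sum[of a K "\<lambda>j. ?k a j * t a j"]) (auto simp: less_imp_le)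
    also have "\<dots> \<le> l"
      unfolding l using kpos t0 a(1) assms(2)
      by (intro member_le_sum[of a K "\<lambda>i. \<Sum>j\<in>K. ?k i j * t i j"]) (auto simp: less_imp_le sum_nonneg)
    finally show ?thesis by (simp add: coupling_def)
  qed
  then have lpos: "0 < l"
    using tpos[OF a(1)] a(2) \<mu> mult_pos_pos[of \<mu> "t a a"] by linarith
  have "l / \<mu> = (\<Sum>i\<in>K. \<Sum>j\<in>K. (if i = j then 1 else \<beta> / \<mu>) * t i j)"
    unfolding l sum_divide_distrib using \<mu> by (intro sum.cong) (auto simp: coupling_def)
  also have "\<dots> \<le> (\<Sum>i\<in>K. \<Sum>j\<in>K. (if i = j then 1 else \<beta> / \<mu>) * (x i * x j) powr ((p + 1) / 2))"
    using \<beta> \<mu> by (intro sum_mono mult_left_mono CS) auto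
  also have "\<dots> < (\<Sum>i\<in>K. x i) powr (p + 1)"
    using \<beta> \<mu> a b ab assms(2,3) x0 xpos by (intro coupled_sum_less_powr_sum) auto
  finally have "(l / \<mu>) powr (1 / (p + 1)) < ((\<Sum>i\<in>K. x i) powr (p + 1)) powr (1 / (p + 1))"
    using lpos \<mu> assms(3) by (intro powr_less_mono2) auto
  then have level: "(l / \<mu>) powr (1 / (p + 1)) < (\<Sum>i\<in>K. x i)"
    using x0 assms(3) by (simp add: powr_powr sum_nonneg)
  obtain m where m: "m \<in> K" "\<not> zero_on \<Omega> (U m)"
    and min: "\<And>i. i \<in> K \<Longrightarrow> \<not> zero_on \<Omega> (U i) \<Longrightarrow> e m / x m \<le> e i / x i"
  proof -
    let ?A = "{i \<in> K. \<not> zero_on \<Omega> (U i)}"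
    have "finite ?A" "?A \<noteq> {}" using assms(2) a by auto
    then obtain m where "m \<in> ?A" "\<forall>i\<in>?A. e m / x m \<le> e i / x i"
      using ex_is_arg_min_if_finite[of ?A "\<lambda>i. e i / x i"] by (auto simp: is_arg_min_linorder)
    with that show thesis by blast
  qed
  define r where "r = e m / x m"
  have epos: "0 < e i" if "i \<in> K" "\<not> zero_on \<Omega> (U i)" for i
    unfolding e_def by (rule energy_pos[OF H1[OF that(1)] \<omega>[OF that(1)] that(2)])
  have rpos: "0 < r" using epos[OF m] xpos[OF m] by (simp add: r_def)
  have rx: "r * x i \<le> e i" if "i \<in> K" for i
  proof (cases "zero_on \<Omega> (U i)")
    case True
    then have "x i = 0" using tpos[OF that] t0[of i i] by (simp add: x_def)
    then show ?thesis using energy_nonneg[of "\<omega> i" \<Omega> "U i"] \<omega>[OF that] by (simp add: e_def)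
  next
    case False
    then show ?thesis using min[OF that False] xpos[OF that False] by (simp add: r_def pos_le_divide_eq)
  qed
  \<comment> \<open>The competitor: \<open>c\<close> is determined by the requirement that it has the level of \<open>U\<close>.\<close>
  define c where "c = (l / (\<mu> * t m m)) powr (1 / (2 * p + 2))"
  define W where "W i = (\<lambda>y. complex_of_real (if i = m then c else 0) * U i y)" for i
  have c: "0 \<le> c" "c powr (2 * p + 2) * (\<mu> * t m m) = l"
    using lpos \<mu> tpos[OF m(1)] m(2) assms(3) by (simp_all add: c_def powr_powr)
  have "W \<in> H10_vec \<Omega> K"
    unfolding H10_vec_def W_def using H10_cmult[OF assms(1) H10] by blast
  moreover have "J_fun \<Omega> p ?k K W = ereal l"
  proof -
    have "overlap \<Omega> p (W m) (W m) = ennreal (c powr (2 * p + 2)) * ennreal (t m m)"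
      using overlap_self_cmult[OF meas[OF m(1)] c(1), of p] ov[OF m(1) m(1)] by (simp add: W_def)
    also have "\<dots> = ennreal (c powr (2 * p + 2) * t m m)"
      using t0 by (simp add: ennreal_mult)
    finally have "enn2ereal (overlap \<Omega> p (W m) (W m)) = ereal (c powr (2 * p + 2) * t m m)"
      using t0 by (simp add: enn2ereal_ennreal)
    moreover have "J_fun \<Omega> p ?k K W = ereal (?k m m) * enn2ereal (overlap \<Omega> p (W m) (W m))"
      by (rule J_fun_single[OF assms(2) m(1)]) (simp add: W_def)
    ultimately show ?thesis using c(2) by (simp add: coupling_def mult_ac)
  qed
  ultimately have "I_fun \<Omega> \<omega> K U \<le> I_fun \<Omega> \<omega> K W"
    using U by (auto simp: minimizers_def l_def)
  also have "I_fun \<Omega> \<omega> K W = c\<^sup>2 * e m"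
  proof -
    have "energy \<Omega> (\<omega> i) (W i) = (if i = m then c\<^sup>2 * e m else 0)" if "i \<in> K" for i
      unfolding W_def energy_cmult[OF assms(1) H1[OF that]] by (simp add: e_def)
    then show ?thesis using assms(2) m(1) by (simp add: I_fun_eq_energy)
  qed
  also have "c\<^sup>2 * e m = r * (c\<^sup>2 * x m)" using xpos[OF m] by (simp add: r_def)
  also have "c\<^sup>2 * x m = (l / \<mu>) powr (1 / (p + 1))"
  proof -
    have "c\<^sup>2 = (l / (\<mu> * t m m)) powr (1 / (p + 1))"
    proof -
      have "1 / (2 * p + 2) + 1 / (2 * p + 2) = 1 / (p + 1)"
        using assms(3) by (simp add: field_simps)
      then show ?thesis by (simp add: c_def power2_eq_square powr_add[symmetric])
    qed
    then have "c\<^sup>2 * x m = (l / (\<mu> * t m m) * t m m) powr (1 / (p + 1))"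
      using lpos \<mu> t0 by (subst powr_mult) (auto simp: x_def)
    then show ?thesis using tpos[OF m(1)] m(2) by simp
  qed
  also have "r * (l / \<mu>) powr (1 / (p + 1)) < r * (\<Sum>i\<in>K. x i)"
    using level rpos by (rule mult_strict_left_mono)
  also have "\<dots> \<le> I_fun \<Omega> \<omega> K U"
    unfolding I_fun_eq_energy sum_distrib_left e_def[symmetric] by (intro sum_mono rx)
  finally show False by simp
qed

theorem proposition6:
  fixes \<Omega> :: "'a::euclidean_space set" and M :: nat and p :: real and \<omega> :: "nat \<Rightarrow> real"
  assumes "M \<ge> 2"
    and "open \<Omega>" and "smooth_boundary \<Omega>"
    and "1 \<le> p" and "ereal p < critical_exponent DIM('a)"
    and "\<forall>i\<in>{1..M}. \<omega> i > 0"
  shows "\<exists>\<delta>>0. \<forall>\<mu> \<beta>. \<mu> > 0 \<longrightarrow> 0 < \<beta> \<longrightarrow> \<beta> < \<delta> * \<mu> \<longrightarrow>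
      (\<forall>K. K \<noteq> {} \<longrightarrow> K \<subseteq> {1..M} \<longrightarrow>
          ground_states \<Omega> p \<omega> (coupling \<mu> \<beta>) K \<noteq> {}) \<longrightarrow>
      (\<forall>K. K \<noteq> {} \<longrightarrow> K \<subseteq> {1..M} \<longrightarrow>
          ground_states \<Omega> p \<omega> (coupling \<mu> \<beta>) K = minimizers \<Omega> p \<omega> (coupling \<mu> \<beta>) K) \<longrightarrow>
      (\<forall>U\<in>ground_states \<Omega> p \<omega> (coupling \<mu> \<beta>) {1..M}.
          card {i\<in>{1..M}. \<not> zero_on \<Omega> (U i)} = 1)"
  \<comment> \<open>\<open>\<delta> = 1\<close>: the coupling only has to be weaker than the self-interaction.\<close>
proof (intro exI[of _ "1::real"] conjI allI impI ballI)
  fix \<mu> \<beta> :: real and U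
  let ?G = "ground_states \<Omega> p \<omega> (coupling \<mu> \<beta>)" and ?A = "{i\<in>{1..M}. \<not> zero_on \<Omega> (U i)}"
  assume \<beta>: "0 < \<beta>" "\<beta> < 1 * \<mu>"
    and min: "\<forall>K. K \<noteq> {} \<longrightarrow> K \<subseteq> {1..M} \<longrightarrow> ?G K = minimizers \<Omega> p \<omega> (coupling \<mu> \<beta>) K"
    and U: "U \<in> ?G {1..M}"
  have "{1..M} \<noteq> {}" using assms(1) by simp
  then have "U \<in> minimizers \<Omega> p \<omega> (coupling \<mu> \<beta>) {1..M}" using min U by blast
  moreover have "\<beta> < \<mu>" using \<beta>(2) by simp
  ultimately have "i = j" if "i \<in> ?A" "j \<in> ?A" for i j
    using that assms(6) \<beta>(1)
    by (intro minimizer_at_most_one_component[OF assms(2) finite_atLeastAtMost assms(4)]) auto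
  moreover obtain i where "i \<in> ?A"
    using U by (auto simp: ground_states_def bound_states_def)
  ultimately have "?A = {i}" by blast
  then show "card ?A = 1" by simp
qed simp

end
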